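(* Let $G$ be an ample Hausdorff groupoid which is strongly effective, and let $R$ be a commutative ring with identity. Let $\mathcal{L}(R)$ denote the set of ideals of $R$ and $\mathcal{L}(A_R(G))$ the set of two-sided ideals of $A_R(G)$. Let $\mathcal{O}$ be the set of all nonempty open invariant subsets of $G^{(0)}$, and let $\mathcal{F}$ be the set of all functions $\pi:\mathcal{O} \to \mathcal{L}(R)$ such that for all nonempty $\mathcal{A} \subseteq \mathcal{O}$ $$\pi\Big(\bigcup_{U \in \mathcal{A}}U\Big) = \bigcap_{U \in \mathcal{A}}\pi(U).$$ There is a bijection $\Gamma:\mathcal{F} \to \mathcal{L}(A_R(G))$ such that $$\Gamma(\pi) = \operatorname{span}_R\Big(\bigcup_{U \in \mathcal{O}} \{rf : r \in \pi(U),\ f \in A_R(G),\ \operatorname{supp}(f) \subseteq G_U\}\Big).$$ For each $\pi\in\mathcal{F}$ and each $U \in \mathcal{O}$, we have $$\pi(U) = \{r \in R : r1_B \in \Gamma(\pi)\text{ for all compact open }B \subseteq U\}.$$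
   Context: Groupoids. $G$ is a topological groupoid with unit space $G^{(0)}$ and range and source maps $r,s:G\to G^{(0)}$. An open bisection is an open set $B\subseteq G$ such that $r$ and $s$ restrict to homeomorphisms of $B$ onto open subsets of $G^{(0)}$. $G$ is ample if it has a basis of compact open bisections. The isotropy is $\operatorname{Iso}(G)=\{\gamma\in G: r(\gamma)=s(\gamma)\}$. An ample Hausdorff groupoid is effective if the interior of $\operatorname{Iso}(G)$ in $G$ equals $G^{(0)}$. A subset $U\subseteq G^{(0)}$ is invariant if $s(\gamma)\in U$ implies $r(\gamma)\in U$ for all $\gamma \in G$; then $G_U:=s^{-1}(U)=\{\gamma: r(\gamma),s(\gamma)\in U\}$ is a groupoid with unit space $U$ (subspace topology). $G$ is strongly effective if $G_V$ is effective for every nonempty closed invariant $V\subseteq G^{(0)}$. Steinberg algebra. $A_R(G)$ is the $R$-algebra of all locally constant, compactly supported functions $f:G\to R$ with pointwise addition and convolution $(f*g)(\gamma)=\sum_{\beta: r(\beta)=r(\gamma)} f(\beta)g(\beta^{-1}\gamma)$. The support is $\operatorname{supp} f=\{\gamma: f(\gamma)\ne 0\}$. $1_B$ denotes the characteristic function of $B$. *)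

theory Defs
  imports "HOL-Analysis.Analysis"
begin

text \<open>
  The unit space is a subset of the set of arrows, and the set of arrows is the carrier of the
  topology. The operations are only meaningful on arrows, and composition only on composable
  pairs.
\<close>

record 'a groupoid =
  gtop :: "'a topology"
  units :: "'a set"
  rng :: "'a \<Rightarrow> 'a"
  src :: "'a \<Rightarrow> 'a"
  comp :: "'a \<Rightarrow> 'a \<Rightarrow> 'a"
  ginv :: "'a \<Rightarrow> 'a"

abbreviation arrows :: "'a groupoid \<Rightarrow> 'a set" where
  "arrows G \<equiv> topspace (gtop G)"

abbreviation unit_space :: "'a groupoid \<Rightarrow> 'a topology" where
  "unit_space G \<equiv> subtopology (gtop G) (units G)"

definition composable :: "'a groupoid \<Rightarrow> ('a \<times> 'a) set" where
  "composable G = {(a, b). a \<in> arrows G \<and> b \<in> arrows G \<and> src G a = rng G b}"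

locale topological_groupoid =
  fixes G :: "'a groupoid"
  assumes units_subset: "units G \<subseteq> arrows G"
    and rng_in: "a \<in> arrows G \<Longrightarrow> rng G a \<in> units G"
    and src_in: "a \<in> arrows G \<Longrightarrow> src G a \<in> units G"
    and rng_unit: "u \<in> units G \<Longrightarrow> rng G u = u"
    and src_unit: "u \<in> units G \<Longrightarrow> src G u = u"
    and comp_in: "(a, b) \<in> composable G \<Longrightarrow> comp G a b \<in> arrows G"
    and rng_comp: "(a, b) \<in> composable G \<Longrightarrow> rng G (comp G a b) = rng G a"
    and src_comp: "(a, b) \<in> composable G \<Longrightarrow> src G (comp G a b) = src G b"
    and comp_assoc: "(a, b) \<in> composable G \<Longrightarrow> (b, c) \<in> composable G \<Longrightarrow>
      comp G (comp G a b) c = comp G a (comp G b c)"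
    and comp_unit_left: "a \<in> arrows G \<Longrightarrow> comp G (rng G a) a = a"
    and comp_unit_right: "a \<in> arrows G \<Longrightarrow> comp G a (src G a) = a"
    and ginv_in: "a \<in> arrows G \<Longrightarrow> ginv G a \<in> arrows G"
    and rng_ginv: "a \<in> arrows G \<Longrightarrow> rng G (ginv G a) = src G a"
    and src_ginv: "a \<in> arrows G \<Longrightarrow> src G (ginv G a) = rng G a"
    and comp_ginv_right: "a \<in> arrows G \<Longrightarrow> comp G a (ginv G a) = rng G a"
    and comp_ginv_left: "a \<in> arrows G \<Longrightarrow> comp G (ginv G a) a = src G a"
    and continuous_rng: "continuous_map (gtop G) (unit_space G) (rng G)"
    and continuous_src: "continuous_map (gtop G) (unit_space G) (src G)"
    and continuous_comp: "continuous_map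
      (subtopology (prod_topology (gtop G) (gtop G)) (composable G)) (gtop G)
      (\<lambda>(a, b). comp G a b)"
    and continuous_ginv: "continuous_map (gtop G) (gtop G) (ginv G)"

definition open_bisection :: "'a groupoid \<Rightarrow> 'a set \<Rightarrow> bool" where
  "open_bisection G B \<longleftrightarrow> openin (gtop G) B \<and>
    (\<forall>f \<in> {rng G, src G}. openin (unit_space G) (f ` B) \<and>
      homeomorphic_map (subtopology (gtop G) B) (subtopology (unit_space G) (f ` B)) f)"

locale ample_Hausdorff_groupoid = topological_groupoid +
  assumes Hausdorff: "Hausdorff_space (gtop G)"
    and ample: "openin (gtop G) W \<Longrightarrow> a \<in> W \<Longrightarrow>
      \<exists>B. compactin (gtop G) B \<and> open_bisection G B \<and> a \<in> B \<and> B \<subseteq> W"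

definition isotropy :: "'a groupoid \<Rightarrow> 'a set" where
  "isotropy G = {a \<in> arrows G. rng G a = src G a}"

definition effective :: "'a groupoid \<Rightarrow> bool" where
  "effective G \<longleftrightarrow> gtop G interior_of isotropy G = units G"

definition invariant :: "'a groupoid \<Rightarrow> 'a set \<Rightarrow> bool" where
  "invariant G U \<longleftrightarrow> U \<subseteq> units G \<and> (\<forall>a \<in> arrows G. src G a \<in> U \<longrightarrow> rng G a \<in> U)"

definition restr_arrows :: "'a groupoid \<Rightarrow> 'a set \<Rightarrow> 'a set" where
  "restr_arrows G U = {a \<in> arrows G. src G a \<in> U}"

definition restr :: "'a groupoid \<Rightarrow> 'a set \<Rightarrow> 'a groupoid" where
  "restr G U = G\<lparr>gtop := subtopology (gtop G) (restr_arrows G U), units := U\<rparr>"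

definition strongly_effective :: "'a groupoid \<Rightarrow> bool" where
  "strongly_effective G \<longleftrightarrow>
    (\<forall>V. V \<noteq> {} \<and> closedin (unit_space G) V \<and> invariant G V \<longrightarrow> effective (restr G V))"

definition open_invariants :: "'a groupoid \<Rightarrow> 'a set set" where
  "open_invariants G = {U. U \<noteq> {} \<and> openin (unit_space G) U \<and> invariant G U}"

text \<open>
  Commutative rings with identity are given by the sort \<open>{comm_ring, comm_monoid_mult}\<close>, which,
  unlike \<open>comm_ring_1\<close>, does not exclude the zero ring. For the same reason \<open>indicator\<close> and
  \<open>module.span\<close> of the library cannot be used.
\<close>

definition ring_ideals :: "'r::{comm_ring, comm_monoid_mult} set set" where
  "ring_ideals = {I. 0 \<in> I \<and> (\<forall>x \<in> I. \<forall>y \<in> I. x + y \<in> I) \<and> (\<forall>c. \<forall>x \<in> I. c * x \<in> I)}"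

definition char_fun :: "'a set \<Rightarrow> 'a \<Rightarrow> 'r::{comm_ring, comm_monoid_mult}" where
  "char_fun B = (\<lambda>a. if a \<in> B then 1 else 0)"

definition scale_fun :: "'r::{comm_ring, comm_monoid_mult} \<Rightarrow> ('a \<Rightarrow> 'r) \<Rightarrow> 'a \<Rightarrow> 'r" where
  "scale_fun c f = (\<lambda>a. c * f a)"

definition supp :: "('a \<Rightarrow> 'r::{comm_ring, comm_monoid_mult}) \<Rightarrow> 'a set" where
  "supp f = {a. f a \<noteq> 0}"

text \<open>
  A function on the set of arrows is represented by its extension by zero to the whole type.
\<close>

definition steinberg :: "'a groupoid \<Rightarrow> ('a \<Rightarrow> 'r::{comm_ring, comm_monoid_mult}) set" where
  "steinberg G = {f. supp f \<subseteq> arrows G \<and>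
    (\<forall>a \<in> arrows G. \<exists>W. openin (gtop G) W \<and> a \<in> W \<and> (\<forall>b \<in> W. f b = f a)) \<and>
    compactin (gtop G) (supp f)}"

text \<open>
  The sum is taken over the arrows in \<open>supp f\<close> only, since \<open>sum\<close> is zero on infinite index sets;
  the omitted terms vanish. For \<open>f\<close> in the Steinberg algebra of an ample groupoid
  the index set is finite, because fibres of the range map meet compact sets in finite sets.
\<close>

definition convolution :: "'a groupoid \<Rightarrow> ('a \<Rightarrow> 'r::{comm_ring, comm_monoid_mult}) \<Rightarrow>
    ('a \<Rightarrow> 'r) \<Rightarrow> 'a \<Rightarrow> 'r" where
  "convolution G f g = (\<lambda>a. if a \<in> arrows G
    then \<Sum>b \<in> {b \<in> arrows G. rng G b = rng G a \<and> b \<in> supp f}. f b * g (comp G (ginv G b) a)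
    else 0)"

text \<open>
  Two-sided ideals of the (in general non-unital) ring: additive subgroups absorbing convolution
  from both sides. Closure under \<open>R\<close>-scaling is not demanded; it is automatic, since the
  Steinberg algebra has local units.
\<close>

definition steinberg_ideals ::
    "'a groupoid \<Rightarrow> ('a \<Rightarrow> 'r::{comm_ring, comm_monoid_mult}) set set" where
  "steinberg_ideals G = {I. I \<subseteq> steinberg G \<and> (\<lambda>a. 0) \<in> I \<and>
    (\<forall>f \<in> I. \<forall>g \<in> I. (\<lambda>a. f a + g a) \<in> I) \<and>
    (\<forall>f \<in> I. (\<lambda>a. - f a) \<in> I) \<and>
    (\<forall>f \<in> I. \<forall>g \<in> steinberg G. convolution G g f \<in> I \<and> convolution G f g \<in> I)}"

definition fun_span ::
    "('a \<Rightarrow> 'r::{comm_ring, comm_monoid_mult}) set \<Rightarrow> ('a \<Rightarrow> 'r) set" where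
  "fun_span S = {(\<lambda>a. \<Sum>f \<in> T. scale_fun (c f) f a) | T c. finite T \<and> T \<subseteq> S}"

definition ideal_functions ::
    "'a groupoid \<Rightarrow> ('a set \<Rightarrow> 'r::{comm_ring, comm_monoid_mult} set) set" where
  "ideal_functions G = {\<pi> \<in> open_invariants G \<rightarrow>\<^sub>E ring_ideals.
    \<forall>\<A>. \<A> \<subseteq> open_invariants G \<and> \<A> \<noteq> {} \<longrightarrow> \<pi> (\<Union>\<A>) = (\<Inter>U \<in> \<A>. \<pi> U)}"

end

theory Submission
  imports Defs
begin

text \<open>
  To an ideal \<open>I\<close> of the Steinberg algebra and a unit \<open>u\<close> attach the ideal \<open>J u\<close> of all scalars \<open>r\<close>
  with \<open>r 1\<^sub>W \<in> I\<close> for some compact open neighbourhood \<open>W\<close> of \<open>u\<close> in the unit space. The heart of the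
  matter is that \<open>I\<close> consists of all \<open>f\<close> in the algebra with \<open>f a \<in> J (src a)\<close> for all arrows \<open>a\<close>. By
  translating with bisections, it suffices to show \<open>f u \<in> J u\<close> for \<open>f \<in> I\<close> and units \<open>u\<close>. Since
  the restriction of the groupoid to the closure of the orbit of \<open>u\<close> is effective, some \<open>w\<close> in this
  orbit, close enough to \<open>u\<close> that \<open>f w = f u\<close>, has no nontrivial isotropy in the support of \<open>f\<close>.
  Then \<open>1\<^sub>K * f * 1\<^sub>K = (f u) 1\<^sub>K\<close> for a small neighbourhood \<open>K\<close> of \<open>w\<close>, and conjugating with a
  bisection through an arrow from \<open>u\<close> to \<open>w\<close> gives the claim. Thus ideals correspond to families
  \<open>J\<close> of ideals of scalars such that every set \<open>{u. r \<in> J u}\<close> is open and invariant, and such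
  families correspond to the functions \<open>\<pi>\<close> via \<open>\<pi> U = (\<Inter>u \<in> U. J u)\<close> and
  \<open>J u = \<Union>{\<pi> U | U. u \<in> U}\<close>.
\<close>

section \<open>Groupoids and locally constant functions\<close>

text \<open>Injectivity stands in for the homeomorphism condition of \<open>open_bisection\<close>:
  in an ample groupoid \<open>rng G\<close> and \<open>src G\<close> are continuous and open, so on
  an open set where they are injective they are homeomorphisms onto open images. In this form the
  notion passes at once to clopen subsets.\<close>

definition compact_open_bisection :: "'a groupoid \<Rightarrow> 'a set \<Rightarrow> bool" where
  "compact_open_bisection G B \<longleftrightarrow> compactin (gtop G) B \<and> openin (gtop G) B \<and>
    inj_on (rng G) B \<and> inj_on (src G) B"

text \<open>Split off from \<open>steinberg\<close> because local constancy and compactness of the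
  support are established by different arguments, notably for convolutions.\<close>

definition locally_constant :: "'a groupoid \<Rightarrow> ('a \<Rightarrow> 'r) \<Rightarrow> bool" where
  "locally_constant G f \<longleftrightarrow>
    (\<forall>a \<in> arrows G. \<exists>W. openin (gtop G) W \<and> a \<in> W \<and> (\<forall>b \<in> W. f b = f a))"

section \<open>Identities for inverses and continuity of the structure maps\<close>

context topological_groupoid
begin

lemma src_arrow: "a \<in> arrows G \<Longrightarrow> src G a \<in> arrows G"
  using src_in units_subset by blast

lemma rng_arrow: "a \<in> arrows G \<Longrightarrow> rng G a \<in> arrows G"
  using rng_in units_subset by blast

lemma src_src: "a \<in> arrows G \<Longrightarrow> src G (src G a) = src G a"
  by (simp add: src_in src_unit)

lemma rng_src: "a \<in> arrows G \<Longrightarrow> rng G (src G a) = src G a"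
  by (simp add: src_in rng_unit)

lemma ginv_unit:
  assumes "u \<in> units G"
  shows "ginv G u = u"
proof -
  have u: "u \<in> arrows G" using assms units_subset by blast
  have "comp G (ginv G u) u = ginv G u"
    using comp_unit_right[OF ginv_in[OF u]] src_ginv[OF u] rng_unit[OF assms] by simp
  then show ?thesis
    using comp_ginv_left[OF u] src_unit[OF assms] by simp
qed

lemma composable_ginv: "\<lbrakk>a \<in> arrows G; b \<in> arrows G; rng G b = rng G a\<rbrakk> \<Longrightarrow> (ginv G b, a) \<in> composable G"
  by (simp add: composable_def ginv_in src_ginv)

lemma comp_ginv_cancel:
  assumes "a \<in> arrows G" "b \<in> arrows G" "rng G b = rng G a"
  shows "comp G b (comp G (ginv G b) a) = a"
proof -
  have "comp G (comp G b (ginv G b)) a = comp G b (comp G (ginv G b) a)"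
    by (rule comp_assoc) (use assms in \<open>auto simp: composable_def ginv_in rng_ginv src_ginv\<close>)
  then show ?thesis using assms comp_ginv_right comp_unit_left by metis
qed

lemma src_ginv_comp: "\<lbrakk>a \<in> arrows G; b \<in> arrows G; rng G b = rng G a\<rbrakk> \<Longrightarrow> src G (comp G (ginv G b) a) = src G a"
  by (simp add: src_comp composable_ginv)

lemma rng_ginv_comp: "\<lbrakk>a \<in> arrows G; b \<in> arrows G; rng G b = rng G a\<rbrakk> \<Longrightarrow> rng G (comp G (ginv G b) a) = src G b"
  by (simp add: rng_comp composable_ginv rng_ginv)

lemma ginv_comp_in: "\<lbrakk>a \<in> arrows G; b \<in> arrows G; rng G b = rng G a\<rbrakk> \<Longrightarrow> comp G (ginv G b) a \<in> arrows G"
  by (simp add: comp_in composable_ginv)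

text \<open>A unit equals its own range, here \<open>src G b\<close>; multiplying by
  \<open>b\<close> on the left then gives \<open>a = b\<close>. This singles out the only surviving
  summand when convolving on the right with a function supported on units.\<close>

lemma ginv_comp_unit_iff:
  assumes "a \<in> arrows G" "b \<in> arrows G" "rng G b = rng G a"
  shows "comp G (ginv G b) a \<in> units G \<longleftrightarrow> b = a"
proof
  assume u: "comp G (ginv G b) a \<in> units G"
  then have "comp G (ginv G b) a = src G b"
    using rng_ginv_comp[OF assms] rng_unit by simp
  then show "b = a"
    using comp_ginv_cancel[OF assms] comp_unit_right assms by metis
qed (use assms comp_ginv_left src_in in auto)

lemma ginv_ginv:
  assumes "a \<in> arrows G"
  shows "ginv G (ginv G a) = a"
proof -
  have "comp G (ginv G (ginv G a)) (src G a) = a"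
    using comp_assoc[of "ginv G (ginv G a)" "ginv G a" a] assms
    by (simp add: composable_def ginv_in src_ginv rng_ginv comp_ginv_left comp_unit_left)
  then show ?thesis
    using comp_unit_right[of "ginv G (ginv G a)"] assms by (simp add: ginv_in src_ginv rng_ginv)
qed

lemma continuous_src': "continuous_map (gtop G) (gtop G) (src G)"
  using continuous_src continuous_map_into_fulltopology by blast

lemma continuous_rng': "continuous_map (gtop G) (gtop G) (rng G)"
  using continuous_rng continuous_map_into_fulltopology by blast

lemma openin_src_vimage: "openin (gtop G) W \<Longrightarrow> openin (gtop G) {a \<in> arrows G. src G a \<in> W}"
  using continuous_src' openin_continuous_map_preimage by blast

lemma openin_rng_vimage: "openin (gtop G) W \<Longrightarrow> openin (gtop G) {a \<in> arrows G. rng G a \<in> W}"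
  using continuous_rng' openin_continuous_map_preimage by blast

lemma homeomorphic_ginv: "homeomorphic_map (gtop G) (gtop G) (ginv G)"
  by (rule homeomorphic_maps_imp_map[where g = "ginv G"])
    (simp add: homeomorphic_maps_def continuous_ginv ginv_ginv)

lemma compact_open_bisection_ginv:
  assumes "compact_open_bisection G B"
  shows "compact_open_bisection G (ginv G ` B)"
proof -
  have B: "B \<subseteq> arrows G"
    using assms compactin_subset_topspace by (auto simp: compact_open_bisection_def)
  have "openin (gtop G) (ginv G ` B)"
    using assms homeomorphic_imp_open_map[OF homeomorphic_ginv]
    by (simp add: open_map_def compact_open_bisection_def)
  moreover have "compactin (gtop G) (ginv G ` B)"
    using assms image_compactin continuous_ginv by (auto simp: compact_open_bisection_def)
  moreover have "inj_on (rng G) (ginv G ` B)"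
  proof (rule inj_on_imageI)
    have "inj_on (rng G \<circ> ginv G) B \<longleftrightarrow> inj_on (src G) B"
      by (rule inj_on_cong) (use B rng_ginv in auto)
    then show "inj_on (rng G \<circ> ginv G) B" using assms by (simp add: compact_open_bisection_def)
  qed
  moreover have "inj_on (src G) (ginv G ` B)"
  proof (rule inj_on_imageI)
    have "inj_on (src G \<circ> ginv G) B \<longleftrightarrow> inj_on (rng G) B"
      by (rule inj_on_cong) (use B src_ginv in auto)
    then show "inj_on (src G \<circ> ginv G) B" using assms by (simp add: compact_open_bisection_def)
  qed
  ultimately show ?thesis by (simp add: compact_open_bisection_def)
qed

end

section \<open>Clopenness of the unit space and stability of compact open bisections\<close>

context ample_Hausdorff_groupoid
begin

lemma open_bisection_inj:
  assumes "open_bisection G B"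
  shows "inj_on (rng G) B" "inj_on (src G) B"
proof -
  have B: "B \<subseteq> arrows G" using assms by (simp add: open_bisection_def openin_subset)
  have "inj_on f B" if "f \<in> {rng G, src G}" for f
    using assms that B homeomorphic_imp_injective_map[of "subtopology (gtop G) B" _ f]
    by (fastforce simp: open_bisection_def Int_absorb1 topspace_subtopology)
  then show "inj_on (rng G) B" "inj_on (src G) B" by auto
qed

text \<open>Let \<open>B\<close> be a bisection through \<open>u\<close>. If both \<open>a\<close>
  and \<open>src G a\<close> lie in \<open>B\<close>, they have the same source, so injectivity
  forces \<open>a = src G a\<close>. Hence the arrows of \<open>B\<close> with source in
  \<open>B\<close> form a neighbourhood of \<open>u\<close> consisting of units.\<close>

lemma openin_units: "openin (gtop G) (units G)"
proof (subst openin_subopen, rule ballI)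
  fix u assume u: "u \<in> units G"
  then obtain B where B: "open_bisection G B" "u \<in> B"
    using ample[OF openin_topspace, of u] units_subset by blast
  let ?T = "B \<inter> {a \<in> arrows G. src G a \<in> B}"
  have oB: "openin (gtop G) B" using B by (simp add: open_bisection_def)
  have "openin (gtop G) ?T" using oB openin_src_vimage by blast
  moreover have "u \<in> ?T" using B u units_subset src_unit by auto
  moreover have "?T \<subseteq> units G"
  proof
    fix a assume a: "a \<in> ?T"
    then have "a = src G a"
      using open_bisection_inj(2)[OF B(1)] src_src[of a] by (auto simp: inj_on_def)
    then show "a \<in> units G" using a src_in by (metis (no_types, lifting) IntD2 mem_Collect_eq)
  qed
  ultimately show "\<exists>T. openin (gtop G) T \<and> u \<in> T \<and> T \<subseteq> units G" by blast
qed

text \<open>The units are the fixed points of the continuous map \<open>src G\<close>, and such a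
  set is closed in a Hausdorff space.\<close>

lemma closedin_units: "closedin (gtop G) (units G)"
proof -
  have "closedin (gtop G) {a \<in> arrows G. src G a = a}"
    by (rule closedin_continuous_maps_eq[OF Hausdorff]) (simp_all add: continuous_src')
  moreover have "{a \<in> arrows G. src G a = a} = units G"
    using units_subset src_unit src_in by fastforce
  ultimately show ?thesis by simp
qed

lemma openin_unit_space: "openin (unit_space G) N \<longleftrightarrow> openin (gtop G) N \<and> N \<subseteq> units G"
  using openin_units openin_open_subtopology by blast

lemma compact_open_bisection_ex:
  assumes "openin (gtop G) W" "a \<in> W"
  obtains B where "compact_open_bisection G B" "a \<in> B" "B \<subseteq> W"
  using ample[OF assms] open_bisection_inj that
  by (metis compact_open_bisection_def open_bisection_def)

text \<open>Open sets are unions of open bisections, whose source images are open by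
  definition.\<close>

lemma openin_src_image:
  assumes "openin (gtop G) W"
  shows "openin (gtop G) (src G ` W)"
proof (subst openin_subopen, rule ballI)
  fix u assume "u \<in> src G ` W"
  then obtain a where "a \<in> W" "u = src G a" by blast
  then obtain B where B: "open_bisection G B" "a \<in> B" "B \<subseteq> W"
    using ample[OF assms] by blast
  then have "openin (gtop G) (src G ` B)"
    by (simp add: open_bisection_def openin_unit_space)
  then show "\<exists>T. openin (gtop G) T \<and> u \<in> T \<and> T \<subseteq> src G ` W"
    using B \<open>u = src G a\<close> by blast
qed

lemma openin_rng_image:
  assumes "openin (gtop G) W"
  shows "openin (gtop G) (rng G ` W)"
proof -
  have W: "W \<subseteq> arrows G" using assms openin_subset by blast
  have "openin (gtop G) (src G ` ginv G ` W)"
    using assms homeomorphic_imp_open_map[OF homeomorphic_ginv]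
    by (intro openin_src_image) (simp add: open_map_def)
  moreover have "src G ` ginv G ` W = rng G ` W"
    using W by (auto simp: image_iff src_ginv subset_iff)
  ultimately show ?thesis by simp
qed

lemma compact_open_bisection_subset:
  assumes "compact_open_bisection G B" "C \<subseteq> B" "openin (gtop G) C" "closedin (gtop G) C"
  shows "compact_open_bisection G C"
  using assms closed_compactin inj_on_subset unfolding compact_open_bisection_def by metis

lemma compact_open_bisection_unitsI:
  assumes "compactin (gtop G) B" "openin (gtop G) B" "B \<subseteq> units G"
  shows "compact_open_bisection G B"
  using assms unfolding compact_open_bisection_def inj_on_def
  by (metis rng_unit src_unit subsetD)

text \<open>Compact open sets are clopen in a Hausdorff space. This is what makes it possible to
  turn finite covers by bisections into disjoint ones.\<close>

lemma compact_open_bisection_Diff: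
  assumes "compact_open_bisection G B" "compactin (gtop G) K" "openin (gtop G) K"
  shows "compact_open_bisection G (B - K)"
proof (rule compact_open_bisection_subset[OF assms(1)])
  show "openin (gtop G) (B - K)"
    using assms compactin_imp_closedin[OF Hausdorff] openin_diff
    by (auto simp: compact_open_bisection_def)
  show "closedin (gtop G) (B - K)"
    using assms compactin_imp_closedin[OF Hausdorff] closedin_diff
    by (auto simp: compact_open_bisection_def)
qed auto

lemma compact_open_bisection_src:
  assumes "compact_open_bisection G B"
  shows "compact_open_bisection G (src G ` B)"
proof (rule compact_open_bisection_unitsI)
  show "src G ` B \<subseteq> units G"
    using assms src_in compactin_subset_topspace by (fastforce simp: compact_open_bisection_def)
qed (use assms openin_src_image image_compactin[OF _ continuous_src'] in
    \<open>auto simp: compact_open_bisection_def\<close>)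

section \<open>Locally constant functions with compact support\<close>

lemma supp_closedin:
  assumes "locally_constant G f" "supp f \<subseteq> arrows G"
  shows "closedin (gtop G) (supp f)"
proof -
  have "openin (gtop G) (arrows G - supp f)"
  proof (subst openin_subopen, rule ballI)
    fix a assume a: "a \<in> arrows G - supp f"
    then obtain W where W: "openin (gtop G) W" "a \<in> W" "\<forall>b\<in>W. f b = f a"
      using assms unfolding locally_constant_def by blast
    show "\<exists>T. openin (gtop G) T \<and> a \<in> T \<and> T \<subseteq> arrows G - supp f"
    proof (intro exI[of _ W] conjI subsetI)
      fix b assume b: "b \<in> W"
      then have "f b = f a" using W(3) by blast
      then show "b \<in> arrows G - supp f" using a b openin_subset[OF W(1)] by (auto simp: supp_def)
    qed (use W in blast)+
  qed
  then show ?thesis using assms(2) by (simp add: closedin_def)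
qed

text \<open>The support is closed, hence compact as soon as it lies in some compact set. No exact
  computation of supports is required.\<close>

lemma steinbergI:
  assumes "locally_constant G f" "supp f \<subseteq> K" "compactin (gtop G) K"
  shows "f \<in> steinberg G"
proof -
  have "supp f \<subseteq> arrows G" using assms(2) compactin_subset_topspace[OF assms(3)] by blast
  then show ?thesis
    using closed_compactin[OF assms(3,2) supp_closedin[OF assms(1)]] assms(1)
    by (simp add: steinberg_def locally_constant_def)
qed

lemma steinberg_locally_constant: "f \<in> steinberg G \<Longrightarrow> locally_constant G f"
  by (simp add: steinberg_def locally_constant_def)

lemma steinberg_compact_supp: "f \<in> steinberg G \<Longrightarrow> compactin (gtop G) (supp f)"
  by (simp add: steinberg_def)

lemma steinberg_outside: "f \<in> steinberg G \<Longrightarrow> a \<notin> arrows G \<Longrightarrow> f a = 0"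
  by (auto simp: steinberg_def supp_def)

lemma locally_constant_level:
  assumes "locally_constant G f"
  shows "openin (gtop G) {a \<in> arrows G. P (f a)}"
proof (subst openin_subopen, rule ballI)
  fix a assume a: "a \<in> {a \<in> arrows G. P (f a)}"
  then obtain W where W: "openin (gtop G) W" "a \<in> W" "\<forall>b\<in>W. f b = f a"
    using assms unfolding locally_constant_def by blast
  show "\<exists>T. openin (gtop G) T \<and> a \<in> T \<and> T \<subseteq> {a \<in> arrows G. P (f a)}"
  proof (intro exI[of _ W] conjI subsetI)
    fix b assume b: "b \<in> W"
    then have "f b = f a" using W(3) by blast
    then show "b \<in> {a \<in> arrows G. P (f a)}" using a b openin_subset[OF W(1)] by auto
  qed (use W in blast)+
qed

lemma locally_constant_combine:
  assumes "locally_constant G f" "locally_constant G g"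
  shows "locally_constant G (\<lambda>a. h (f a) (g a))"
  unfolding locally_constant_def
proof
  fix a assume a: "a \<in> arrows G"
  obtain W where W: "openin (gtop G) W" "a \<in> W" "\<forall>b\<in>W. f b = f a"
    using assms(1) a unfolding locally_constant_def by blast
  obtain W' where W': "openin (gtop G) W'" "a \<in> W'" "\<forall>b\<in>W'. g b = g a"
    using assms(2) a unfolding locally_constant_def by blast
  show "\<exists>W. openin (gtop G) W \<and> a \<in> W \<and> (\<forall>b\<in>W. h (f b) (g b) = h (f a) (g a))"
  proof (intro exI conjI)
    show "openin (gtop G) (W \<inter> W')" using W(1) W'(1) by blast
    show "a \<in> W \<inter> W'" using W(2) W'(2) by blast
    show "\<forall>b\<in>W \<inter> W'. h (f b) (g b) = h (f a) (g a)"
    proof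
      fix b assume "b \<in> W \<inter> W'"
      then have "f b = f a" "g b = g a" using W(3) W'(3) by blast+
      then show "h (f b) (g b) = h (f a) (g a)" by simp
    qed
  qed
qed

lemma steinberg_zero: "(\<lambda>a. 0) \<in> steinberg G"
  by (rule steinbergI[of _ "{}"]) (auto simp: locally_constant_def supp_def)

lemma steinberg_add:
  assumes "f \<in> steinberg G" "g \<in> steinberg G"
  shows "(\<lambda>a. f a + g a) \<in> steinberg G"
proof (rule steinbergI)
  show "locally_constant G (\<lambda>a. f a + g a)"
    using assms steinberg_locally_constant locally_constant_combine by blast
  show "supp (\<lambda>a. f a + g a) \<subseteq> supp f \<union> supp g" by (auto simp: supp_def)
qed (use assms steinberg_compact_supp compactin_Un in blast)

lemma steinberg_scale:
  assumes "f \<in> steinberg G"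
  shows "scale_fun c f \<in> steinberg G"
proof (rule steinbergI)
  show "locally_constant G (scale_fun c f)"
    using assms steinberg_locally_constant locally_constant_combine[of f f "\<lambda>x y. c * x"]
    unfolding scale_fun_def by blast
  show "supp (scale_fun c f) \<subseteq> supp f" by (auto simp: supp_def scale_fun_def)
qed (use assms steinberg_compact_supp in blast)

lemma steinberg_char:
  assumes "compactin (gtop G) B" "openin (gtop G) B"
  shows "char_fun B \<in> steinberg G"
proof (rule steinbergI)
  have "openin (gtop G) (arrows G - B)"
    using assms compactin_imp_closedin[OF Hausdorff] by blast
  show "locally_constant G (char_fun B)"
    unfolding locally_constant_def
  proof
    fix a assume "a \<in> arrows G"
    then show "\<exists>W. openin (gtop G) W \<and> a \<in> W \<and> (\<forall>b\<in>W. char_fun B b = char_fun B a)"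
      using assms(2) \<open>openin (gtop G) (arrows G - B)\<close>
      by (intro exI[of _ "if a \<in> B then B else arrows G - B"]) (auto simp: char_fun_def)
  qed
  show "supp (char_fun B) \<subseteq> B" by (auto simp: supp_def char_fun_def)
qed (use assms in blast)

lemma steinberg_scale_char:
  "compact_open_bisection G B \<Longrightarrow> scale_fun c (char_fun B) \<in> steinberg G"
  by (simp add: steinberg_scale steinberg_char compact_open_bisection_def)

text \<open>
  Cutting a function into multiples of characteristic functions turns membership in an additive
  set into a local question.
\<close>

lemma steinberg_local_membership:
  fixes f :: "'a \<Rightarrow> 'r::{comm_ring, comm_monoid_mult}"
  assumes f: "f \<in> steinberg G"
    and zero: "(\<lambda>a. 0) \<in> S"
    and add: "\<And>g h. \<lbrakk>g \<in> S; h \<in> S\<rbrakk> \<Longrightarrow> (\<lambda>a. g a + h a) \<in> S"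
    and local: "\<And>a. \<lbrakk>a \<in> arrows G; f a \<noteq> 0\<rbrakk> \<Longrightarrow> \<exists>N. openin (gtop G) N \<and> a \<in> N \<and>
      (\<forall>B. compact_open_bisection G B \<and> B \<subseteq> N \<longrightarrow> scale_fun (f a) (char_fun B) \<in> S)"
  shows "f \<in> S"
proof -
  \<comment> \<open>Membership is demanded for all smaller bisections \<open>C\<close> as well,
    since the induction below trims the members of the cover to make them disjoint.\<close>
  define good where "good = {B. compact_open_bisection G B \<and> (\<exists>r. (\<forall>b\<in>B. f b = r) \<and>
    (\<forall>C. compact_open_bisection G C \<and> C \<subseteq> B \<longrightarrow> scale_fun r (char_fun C) \<in> S))}"
  have cover: "supp f \<subseteq> \<Union>good"
  proof
    fix a assume "a \<in> supp f"
    then have a: "a \<in> arrows G" "f a \<noteq> 0"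
      using f by (auto simp: steinberg_def supp_def)
    obtain N where N: "openin (gtop G) N" "a \<in> N"
      "\<forall>B. compact_open_bisection G B \<and> B \<subseteq> N \<longrightarrow> scale_fun (f a) (char_fun B) \<in> S"
      using local[OF a] by blast
    have "openin (gtop G) (N \<inter> {b \<in> arrows G. f b = f a})"
      using openin_Int N(1) locally_constant_level[OF steinberg_locally_constant[OF f], where P = "\<lambda>y. y = f a"]
      by blast
    then obtain B where B: "compact_open_bisection G B" "a \<in> B" "B \<subseteq> N \<inter> {b \<in> arrows G. f b = f a}"
      using compact_open_bisection_ex[of _ a] N a by blast
    then have "\<forall>b\<in>B. f b = f a" by blast
    moreover have "\<forall>C. compact_open_bisection G C \<and> C \<subseteq> B \<longrightarrow> scale_fun (f a) (char_fun C) \<in> S"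
      using B(3) N(3) by blast
    ultimately have "B \<in> good"
      unfolding good_def by (intro CollectI conjI exI[of _ "f a"] B(1))
    then show "a \<in> \<Union>good" using B by blast
  qed
  have "\<exists>F. finite F \<and> F \<subseteq> good \<and> supp f \<subseteq> \<Union>F"
    by (rule compactinD[OF steinberg_compact_supp[OF f] _ cover])
      (simp add: good_def compact_open_bisection_def)
  then obtain F where F: "finite F" "F \<subseteq> good" "supp f \<subseteq> \<Union>F" by blast
  have "(\<lambda>a. if a \<in> \<Union>F then f a else 0) \<in> S"
    using F(1,2)
  proof (induction F rule: finite_induct)
    case empty
    then show ?case using zero by simp
  next
    case (insert B F)
    obtain r where B: "compact_open_bisection G B" "\<forall>b\<in>B. f b = r"
      and r: "\<forall>C. compact_open_bisection G C \<and> C \<subseteq> B \<longrightarrow> scale_fun r (char_fun C) \<in> S"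
      using insert.prems by (auto simp: good_def)
    have "compactin (gtop G) (\<Union>F)" "openin (gtop G) (\<Union>F)"
      using insert by (auto intro!: compactin_Union simp: good_def compact_open_bisection_def)
    \<comment> \<open>Only the part of \<open>B\<close> not yet covered is added, so that no value
      of \<open>f\<close> is counted twice.\<close>
    then have "compact_open_bisection G (B - \<Union>F)"
      using compact_open_bisection_Diff B by blast
    then have "scale_fun r (char_fun (B - \<Union>F)) \<in> S" using r by blast
    then have "(\<lambda>a. (if a \<in> \<Union>F then f a else 0) + scale_fun r (char_fun (B - \<Union>F)) a) \<in> S"
      using insert add by blast
    also have "(\<lambda>a. (if a \<in> \<Union>F then f a else 0) + scale_fun r (char_fun (B - \<Union>F)) a) =
      (\<lambda>a. if a \<in> \<Union>(insert B F) then f a else 0)"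
      using B by (auto simp: scale_fun_def char_fun_def)
    finally show ?case .
  qed
  moreover have "(\<lambda>a. if a \<in> \<Union>F then f a else 0) = f"
    using F(3) by (intro ext) (auto simp: supp_def)
  ultimately show ?thesis by simp
qed

end

section \<open>Convolution\<close>

context ample_Hausdorff_groupoid
begin

text \<open>The property is stable under sums, and a bisection meets each fibre of
  \<open>rng G\<close> in at most one arrow, so \<open>steinberg_local_membership\<close>
  applies.\<close>

lemma finite_fibre:
  fixes f :: "'a \<Rightarrow> 'r::{comm_ring, comm_monoid_mult}"
  assumes "f \<in> steinberg G"
  shows "finite {b \<in> arrows G. rng G b = x \<and> f b \<noteq> 0}"
proof -
  have "f \<in> {f. finite {b \<in> arrows G. rng G b = x \<and> f b \<noteq> 0}}"
  proof (rule steinberg_local_membership[OF assms], goal_cases)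
    case (2 g h)
    then have "finite ({b \<in> arrows G. rng G b = x \<and> g b \<noteq> 0} \<union> {b \<in> arrows G. rng G b = x \<and> h b \<noteq> 0})"
      by simp
    moreover have "{b \<in> arrows G. rng G b = x \<and> g b + h b \<noteq> 0} \<subseteq>
      {b \<in> arrows G. rng G b = x \<and> g b \<noteq> 0} \<union> {b \<in> arrows G. rng G b = x \<and> h b \<noteq> 0}"
      by auto
    ultimately show ?case using finite_subset by blast
  next
    case (3 a)
    have "finite {b \<in> arrows G. rng G b = x \<and> scale_fun (f a) (char_fun B) b \<noteq> 0}"
      if B: "compact_open_bisection G B" for B
    proof (rule finite_subset)
      show "{b \<in> arrows G. rng G b = x \<and> scale_fun (f a) (char_fun B) b \<noteq> 0} \<subseteq> {b \<in> B. rng G b = x}"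
        by (auto simp: scale_fun_def char_fun_def split: if_splits)
      show "finite {b \<in> B. rng G b = x}"
      proof (rule finite_imageD)
        show "finite (rng G ` {b \<in> B. rng G b = x})"
          by (rule finite_subset[of _ "{x}"]) auto
        show "inj_on (rng G) {b \<in> B. rng G b = x}"
          using B by (auto simp: compact_open_bisection_def intro: inj_on_subset)
      qed
    qed
    then show ?case using 3 by blast
  qed simp
  then show ?thesis by simp
qed

text \<open>The freedom in the index set allows several convolutions to be summed over one common
  set, and zero terms to be included at will.\<close>

lemma convolution_eq_sum:
  assumes "a \<in> arrows G" "finite S" "S \<subseteq> {b \<in> arrows G. rng G b = rng G a}"
    and "\<And>b. \<lbrakk>b \<in> arrows G; rng G b = rng G a; f b \<noteq> 0\<rbrakk> \<Longrightarrow> b \<in> S"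
  shows "convolution G f g a = (\<Sum>b\<in>S. f b * g (comp G (ginv G b) a))"
  unfolding convolution_def using assms
  by (auto simp: supp_def intro!: sum.mono_neutral_left)

lemma convolution_outside: "a \<notin> arrows G \<Longrightarrow> convolution G f g a = 0"
  by (simp add: convolution_def)

lemma convolution_zero_left: "convolution G (\<lambda>a. 0) g = (\<lambda>a. 0)"
  by (auto simp: convolution_def)

lemma convolution_add_left:
  assumes "f \<in> steinberg G" "f' \<in> steinberg G"
  shows "convolution G (\<lambda>a. f a + f' a) g = (\<lambda>a. convolution G f g a + convolution G f' g a)"
proof
  fix a
  show "convolution G (\<lambda>a. f a + f' a) g a = convolution G f g a + convolution G f' g a"
  proof (cases "a \<in> arrows G")
    case True
    let ?S = "{b \<in> arrows G. rng G b = rng G a \<and> f b \<noteq> 0} \<union> {b \<in> arrows G. rng G b = rng G a \<and> f' b \<noteq> 0}"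
    have fin: "finite ?S" using assms finite_fibre by blast
    have eq: "convolution G h g a = (\<Sum>b\<in>?S. h b * g (comp G (ginv G b) a))"
      if "\<And>b. h b \<noteq> 0 \<Longrightarrow> f b \<noteq> 0 \<or> f' b \<noteq> 0" for h
      by (rule convolution_eq_sum[OF True fin]) (use that in auto)
    have "convolution G (\<lambda>a. f a + f' a) g a =
      (\<Sum>b\<in>?S. (f b + f' b) * g (comp G (ginv G b) a))"
      by (rule eq) auto
    also have "\<dots> = convolution G f g a + convolution G f' g a"
      using eq[of f] eq[of f'] by (simp add: distrib_right sum.distrib)
    finally show ?thesis .
  qed (simp add: convolution_outside)
qed

text \<open>Injectivity of \<open>rng G\<close> on \<open>B\<close> leaves \<open>b\<close> as the
  only summand. Convolving with a bisection is thus translation by its arrows, up to the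
  scalar.\<close>

lemma convolution_char_left:
  assumes "inj_on (rng G) B" "B \<subseteq> arrows G" "b \<in> B" "a \<in> arrows G" "rng G b = rng G a"
  shows "convolution G (scale_fun c (char_fun B)) g a = c * g (comp G (ginv G b) a)"
proof -
  have "convolution G (scale_fun c (char_fun B)) g a =
    (\<Sum>b\<in>{b}. scale_fun c (char_fun B) b * g (comp G (ginv G b) a))"
    by (rule convolution_eq_sum)
      (use assms in \<open>auto simp: scale_fun_def char_fun_def inj_on_def split: if_splits\<close>)
  then show ?thesis using assms by (simp add: scale_fun_def char_fun_def)
qed

lemma convolution_char_left_zero:
  assumes "rng G a \<notin> rng G ` B"
  shows "convolution G (scale_fun c (char_fun B)) g a = 0"
proof (cases "a \<in> arrows G")
  case True
  have "convolution G (scale_fun c (char_fun B)) g a =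
    (\<Sum>b\<in>{}. scale_fun c (char_fun B) b * g (comp G (ginv G b) a))"
    by (rule convolution_eq_sum) (use assms True in
        \<open>auto simp: scale_fun_def char_fun_def image_iff split: if_splits\<close>)
  then show ?thesis by simp
qed (simp add: convolution_outside)

lemma convolution_units_left:
  assumes "K \<subseteq> units G" "g \<in> steinberg G"
  shows "convolution G (scale_fun c (char_fun K)) g = (\<lambda>a. if rng G a \<in> K then c * g a else 0)"
proof
  fix a
  have inj: "inj_on (rng G) K" using assms(1) by (auto simp: inj_on_def rng_unit subset_iff)
  have img: "rng G ` K = K" using assms rng_unit by (auto simp: subset_iff image_iff)
  show "convolution G (scale_fun c (char_fun K)) g a = (if rng G a \<in> K then c * g a else 0)"
  proof (cases "a \<in> arrows G")
    case a: True
    show ?thesis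
    proof (cases "rng G a \<in> K")
      case True
      have "convolution G (scale_fun c (char_fun K)) g a = c * g (comp G (ginv G (rng G a)) a)"
        by (rule convolution_char_left) (use inj assms(1) units_subset True a rng_in rng_unit in auto)
      then show ?thesis using True a by (simp add: ginv_unit rng_in comp_unit_left)
    next
      case False
      then show ?thesis by (simp add: convolution_char_left_zero img)
    qed
  next
    case False
    then show ?thesis using assms by (simp add: convolution_outside steinberg_outside)
  qed
qed

lemma convolution_units_right:
  assumes "K \<subseteq> units G" "f \<in> steinberg G"
  shows "convolution G f (scale_fun c (char_fun K)) = (\<lambda>a. if src G a \<in> K then f a * c else 0)"
proof
  fix a
  show "convolution G f (scale_fun c (char_fun K)) a = (if src G a \<in> K then f a * c else 0)"
  proof (cases "a \<in> arrows G")
    case a: True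
    let ?S = "{b \<in> arrows G. rng G b = rng G a \<and> f b \<noteq> 0}"
    let ?k = "\<lambda>b. f b * scale_fun c (char_fun K) (comp G (ginv G b) a)"
    have fin: "finite ?S" using finite_fibre[OF assms(2)] .
    have 0: "scale_fun c (char_fun K) (comp G (ginv G b) a) = 0" if "b \<in> ?S - {a}" for b
      using that ginv_comp_unit_iff[OF a, of b] assms(1) by (auto simp: scale_fun_def char_fun_def)
    \<comment> \<open>The arrow \<open>a\<close> is inserted because it is missing from the index
      set when \<open>f a = 0\<close>; every other term vanishes by
      \<open>ginv_comp_unit_iff\<close>.\<close>
    have "convolution G f (scale_fun c (char_fun K)) a = (\<Sum>b\<in>insert a ?S. ?k b)"
      by (rule convolution_eq_sum) (use a fin in auto)
    also have "\<dots> = (\<Sum>b\<in>{a}. ?k b)"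
      by (rule sum.mono_neutral_right) (use fin 0 in auto)
    also have "\<dots> = (if src G a \<in> K then f a * c else 0)"
      using a by (simp add: comp_ginv_left scale_fun_def char_fun_def)
    finally show ?thesis .
  next
    case False
    then show ?thesis using assms by (simp add: convolution_outside steinberg_outside)
  qed
qed

lemma convolution_nonzeroE:
  assumes "convolution G f g a \<noteq> 0"
  obtains b where "a \<in> arrows G" "b \<in> arrows G" "rng G b = rng G a" "f b \<noteq> 0"
    "g (comp G (ginv G b) a) \<noteq> 0"
proof -
  have a: "a \<in> arrows G" using assms convolution_outside by blast
  then have "(\<Sum>b \<in> {b \<in> arrows G. rng G b = rng G a \<and> b \<in> supp f}. f b * g (comp G (ginv G b) a)) \<noteq> 0"
    using assms by (simp add: convolution_def)
  then obtain b where "b \<in> {b \<in> arrows G. rng G b = rng G a \<and> b \<in> supp f}"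
    "f b * g (comp G (ginv G b) a) \<noteq> 0"
    by (rule sum.not_neutral_contains_not_neutral)
  moreover then have "g (comp G (ginv G b) a) \<noteq> 0" by auto
  ultimately show ?thesis using a that by (auto simp: supp_def)
qed

section \<open>Closure of the Steinberg algebra under convolution\<close>

lemma closedin_composable: "closedin (prod_topology (gtop G) (gtop G)) (composable G)"
proof -
  have "closedin (prod_topology (gtop G) (gtop G))
    {p \<in> topspace (prod_topology (gtop G) (gtop G)). (src G \<circ> fst) p = (rng G \<circ> snd) p}"
    by (rule closedin_continuous_maps_eq[OF Hausdorff])
      (rule continuous_map_compose continuous_map_fst continuous_map_snd continuous_src' continuous_rng')+
  moreover have "{p \<in> topspace (prod_topology (gtop G) (gtop G)). (src G \<circ> fst) p = (rng G \<circ> snd) p} =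
    composable G"
    by (auto simp: composable_def)
  ultimately show ?thesis by simp
qed

text \<open>Composition is continuous only on composable pairs. These form a closed set, so they cut
  a compact subset out of the compact product.\<close>

lemma compactin_comp_image:
  assumes "compactin (gtop G) K" "compactin (gtop G) L"
  shows "compactin (gtop G) ((\<lambda>(a, b). comp G a b) ` (K \<times> L \<inter> composable G))"
proof (rule image_compactin[OF _ continuous_comp])
  have "compactin (prod_topology (gtop G) (gtop G)) (K \<times> L)"
    using assms by (simp add: compactin_Times)
  then have "compactin (prod_topology (gtop G) (gtop G)) (K \<times> L \<inter> composable G)"
    using compact_Int_closedin[OF _ closedin_composable] by blast
  then show "compactin (subtopology (prod_topology (gtop G) (gtop G)) (composable G)) (K \<times> L \<inter> composable G)"
    by (simp add: compactin_subtopology)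
qed

lemma supp_convolution:
  "supp (convolution G f g) \<subseteq> (\<lambda>(a, b). comp G a b) ` (supp f \<times> supp g \<inter> composable G)"
proof
  fix a assume "a \<in> supp (convolution G f g)"
  then have "convolution G f g a \<noteq> 0" by (simp add: supp_def)
  then obtain b where b: "a \<in> arrows G" "b \<in> arrows G" "rng G b = rng G a" "f b \<noteq> 0"
    "g (comp G (ginv G b) a) \<noteq> 0"
    by (rule convolution_nonzeroE)
  then have "(b, comp G (ginv G b) a) \<in> supp f \<times> supp g \<inter> composable G"
    by (auto simp: supp_def composable_def ginv_comp_in rng_ginv_comp)
  moreover have "a = (\<lambda>(a, b). comp G a b) (b, comp G (ginv G b) a)"
    using b by (simp add: comp_ginv_cancel)
  ultimately show "a \<in> (\<lambda>(a, b). comp G a b) ` (supp f \<times> supp g \<inter> composable G)"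
    by blast
qed

text \<open>This is continuity of \<open>(x, y)\<close> going to the composite of the inverse of
  \<open>x\<close> with \<open>y\<close>, expressed by a box around \<open>(b, a)\<close> on whose
  composable part \<open>g\<close> takes a single value.\<close>

lemma locally_constant_ginv_comp:
  assumes g: "locally_constant G g" and ab: "a \<in> arrows G" "b \<in> arrows G" "rng G b = rng G a"
  obtains X Y where "openin (gtop G) X" "openin (gtop G) Y" "b \<in> X" "a \<in> Y"
    "\<And>x y. \<lbrakk>x \<in> X; y \<in> Y; rng G x = rng G y\<rbrakk> \<Longrightarrow>
      g (comp G (ginv G x) y) = g (comp G (ginv G b) a)"
proof -
  let ?P = "prod_topology (gtop G) (gtop G)"
  define Z where "Z = {c \<in> arrows G. g c = g (comp G (ginv G b) a)}"
  have Z: "openin (gtop G) Z"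
    unfolding Z_def by (rule locally_constant_level[OF g])
  \<comment> \<open>Preimages under composition are open only relative to the composable pairs;
    \<open>T\<close> extends the preimage of \<open>Z\<close> to an open set of the whole product,
    where boxes are available.\<close>
  obtain T where T: "openin ?P T"
    "{p \<in> topspace (subtopology ?P (composable G)). (\<lambda>(a, b). comp G a b) p \<in> Z} = T \<inter> composable G"
    using openin_continuous_map_preimage[OF continuous_comp Z] unfolding openin_subtopology by blast
  have mem: "(x, y) \<in> T \<longleftrightarrow> comp G x y \<in> Z" if "(x, y) \<in> composable G" for x y
  proof -
    have "(x, y) \<in> topspace (subtopology ?P (composable G))"
      using that by (auto simp: composable_def)
    then show ?thesis using T(2)[unfolded set_eq_iff, THEN spec, of "(x, y)"] that by auto
  qed
  have "comp G (ginv G b) a \<in> Z"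
    using ab by (simp add: Z_def ginv_comp_in)
  then have "(ginv G b, a) \<in> T"
    using mem composable_ginv ab by blast
  then obtain X Y where XY: "openin (gtop G) X" "openin (gtop G) Y" "ginv G b \<in> X" "a \<in> Y" "X \<times> Y \<subseteq> T"
    using T(1)[unfolded openin_prod_topology_alt, rule_format, of "ginv G b" a] by metis
  show ?thesis
  proof (rule that)
    show "openin (gtop G) {x \<in> arrows G. ginv G x \<in> X}"
      using openin_continuous_map_preimage[OF continuous_ginv XY(1)] .
    show "openin (gtop G) Y" "a \<in> Y" using XY by auto
    show "b \<in> {x \<in> arrows G. ginv G x \<in> X}" using XY ab by simp
    fix x y assume xy: "x \<in> {x \<in> arrows G. ginv G x \<in> X}" "y \<in> Y" "rng G x = rng G y"
    have "y \<in> arrows G" using xy(2) openin_subset[OF XY(2)] by blast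
    then have "comp G (ginv G x) y \<in> Z"
      using mem[of "ginv G x" y] composable_ginv[of y x] xy XY(5) by blast
    then show "g (comp G (ginv G x) y) = g (comp G (ginv G b) a)"
      by (simp add: Z_def)
  qed
qed

lemma locally_constant_convolution_char_left:
  assumes B: "compact_open_bisection G B" and g: "locally_constant G g"
  shows "locally_constant G (convolution G (scale_fun c (char_fun B)) g)"
  unfolding locally_constant_def
proof
  let ?h = "convolution G (scale_fun c (char_fun B)) g"
  have B': "compactin (gtop G) B" "openin (gtop G) B" "inj_on (rng G) B" "B \<subseteq> arrows G"
    using B openin_subset by (auto simp: compact_open_bisection_def)
  fix a assume a: "a \<in> arrows G"
  show "\<exists>W. openin (gtop G) W \<and> a \<in> W \<and> (\<forall>b\<in>W. ?h b = ?h a)"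
  proof (cases "rng G a \<in> rng G ` B")
    case True
    then obtain b where b: "b \<in> B" "rng G b = rng G a" by auto
    then have b': "b \<in> arrows G" using B' by blast
    obtain X Y where X: "openin (gtop G) X" "b \<in> X" and Y: "openin (gtop G) Y" "a \<in> Y"
      and XY: "\<And>x y. \<lbrakk>x \<in> X; y \<in> Y; rng G x = rng G y\<rbrakk> \<Longrightarrow>
        g (comp G (ginv G x) y) = g (comp G (ginv G b) a)"
      using locally_constant_ginv_comp[OF g a b' b(2)] by metis
    \<comment> \<open>For \<open>y\<close> in \<open>W\<close>, the arrow of \<open>B\<close> with
      the range of \<open>y\<close> can be found inside \<open>X\<close>, so the box property
      applies to the single summand at \<open>y\<close>.\<close>
    define W where "W = Y \<inter> {y \<in> arrows G. rng G y \<in> rng G ` (X \<inter> B)}"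
    have "openin (gtop G) W"
      unfolding W_def using X B' Y by (intro openin_Int openin_rng_vimage openin_rng_image) auto
    moreover have "rng G a \<in> rng G ` (X \<inter> B)" using b X by (metis IntI imageI)
    then have "a \<in> W" unfolding W_def using Y a by blast
    moreover have "?h y = ?h a" if "y \<in> W" for y
    proof -
      have y: "y \<in> Y" "y \<in> arrows G" "rng G y \<in> rng G ` (X \<inter> B)"
        using that unfolding W_def by blast+
      obtain x where x: "x \<in> X" "x \<in> B" "rng G x = rng G y"
        using y(3) by fastforce
      have "?h y = c * g (comp G (ginv G x) y)"
        using convolution_char_left[OF B'(3,4) x(2) y(2) x(3)] .
      also have "\<dots> = c * g (comp G (ginv G b) a)" using XY x y by simp
      also have "\<dots> = ?h a"
        using convolution_char_left[OF B'(3,4) b(1) a b(2), symmetric] .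
      finally show ?thesis .
    qed
    ultimately show ?thesis by blast
  next
    case False
    \<comment> \<open>Compactness of \<open>B\<close> makes its range image closed, so the
      convolution vanishes on a whole neighbourhood of \<open>a\<close>.\<close>
    have "closedin (gtop G) (rng G ` B)"
      using image_compactin[OF B'(1) continuous_rng'] compactin_imp_closedin[OF Hausdorff] by blast
    then have "openin (gtop G) {y \<in> arrows G. rng G y \<in> arrows G - rng G ` B}"
      by (intro openin_rng_vimage) (simp add: openin_diff)
    moreover have "a \<in> {y \<in> arrows G. rng G y \<in> arrows G - rng G ` B}"
      using a False rng_arrow by blast
    moreover have "?h y = ?h a" if "y \<in> {y \<in> arrows G. rng G y \<in> arrows G - rng G ` B}" for y
      using that False by (simp add: convolution_char_left_zero)
    ultimately show ?thesis by blast
  qed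
qed

lemma steinberg_convolution:
  assumes f: "f \<in> steinberg G" and g: "g \<in> steinberg G"
  shows "convolution G f g \<in> steinberg G"
proof (rule steinbergI[OF _ supp_convolution])
  \<comment> \<open>Membership in \<open>steinberg G\<close> is carried along because additivity of
    convolution relies on the finiteness of fibres.\<close>
  have "f \<in> {f \<in> steinberg G. locally_constant G (convolution G f g)}"
  proof (rule steinberg_local_membership[OF f], goal_cases)
    case 1
    then show ?case
      using steinberg_locally_constant[OF steinberg_zero] by (simp add: steinberg_zero convolution_zero_left)
  next
    case (2 h k)
    then show ?case
      by (simp add: steinberg_add convolution_add_left locally_constant_combine[where h = "(+)"])
  next
    case (3 a)
    then show ?case
      by (intro exI[of _ "arrows G"])
        (simp add: locally_constant_convolution_char_left steinberg_locally_constant[OF g] steinberg_scale_char)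
  qed
  then show "locally_constant G (convolution G f g)" by simp
qed (rule compactin_comp_image[OF steinberg_compact_supp[OF f] steinberg_compact_supp[OF g]])

end

section \<open>Isotropy over orbit closures\<close>

definition orbit :: "'a groupoid \<Rightarrow> 'a \<Rightarrow> 'a set" where
  "orbit G u = {rng G a | a. a \<in> arrows G \<and> src G a = u}"

context ample_Hausdorff_groupoid
begin

lemma orbit_subset_units: "orbit G u \<subseteq> units G"
  using rng_in by (auto simp: orbit_def)

lemma self_in_orbit:
  assumes "u \<in> units G"
  shows "u \<in> orbit G u"
  unfolding orbit_def using assms units_subset rng_unit src_unit by (intro CollectI exI[of _ u]) auto

lemma orbit_invariant:
  assumes "a \<in> arrows G" "src G a \<in> orbit G u"
  shows "rng G a \<in> orbit G u"
proof -
  obtain b where b: "b \<in> arrows G" "src G b = u" "src G a = rng G b"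
    using assms(2) by (auto simp: orbit_def)
  then have "(a, b) \<in> composable G" using assms(1) by (simp add: composable_def)
  then show ?thesis
    unfolding orbit_def using b comp_in rng_comp src_comp
    by (intro CollectI exI[of _ "comp G a b"]) auto
qed

lemma in_orbit_closure:
  "v \<in> unit_space G closure_of orbit G u \<longleftrightarrow>
    v \<in> units G \<and> (\<forall>N. openin (gtop G) N \<and> N \<subseteq> units G \<and> v \<in> N \<longrightarrow> N \<inter> orbit G u \<noteq> {})"
proof -
  have "topspace (unit_space G) = units G" using units_subset by auto
  then show ?thesis unfolding in_closure_of openin_unit_space by blast
qed

lemma orbit_closure_invariant: "invariant G (unit_space G closure_of orbit G u)"
  unfolding invariant_def
proof (intro conjI ballI impI)
  show "unit_space G closure_of orbit G u \<subseteq> units G" using in_orbit_closure by blast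
  fix a assume a: "a \<in> arrows G" "src G a \<in> unit_space G closure_of orbit G u"
  show "rng G a \<in> unit_space G closure_of orbit G u"
    unfolding in_orbit_closure
  proof (intro conjI allI impI)
    show "rng G a \<in> units G" using a rng_in by blast
    fix N assume N: "openin (gtop G) N \<and> N \<subseteq> units G \<and> rng G a \<in> N"
    \<comment> \<open>The neighbourhood \<open>N\<close> of \<open>rng G a\<close> is carried back
      to one of \<open>src G a\<close>, using that \<open>src G\<close> is open. An orbit point
      found there is moved into \<open>N\<close> by some arrow.\<close>
    let ?M = "src G ` {b \<in> arrows G. rng G b \<in> N}"
    have "openin (gtop G) ?M" using N openin_src_image openin_rng_vimage by blast
    moreover have "?M \<subseteq> units G" using src_in by blast
    moreover have "src G a \<in> ?M" using a N by blast
    ultimately obtain b where "b \<in> arrows G" "rng G b \<in> N" "src G b \<in> orbit G u"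
      using a(2) in_orbit_closure by blast
    then show "N \<inter> orbit G u \<noteq> {}" using orbit_invariant by blast
  qed
qed

text \<open>
  The assertion for one bisection, over an arbitrary \<open>N\<close>, is that its isotropy lies over a nowhere
  dense subset of \<open>V\<close>; shrinking \<open>N\<close> repeatedly handles finitely many.
\<close>

lemma avoid_isotropy:
  assumes se: "strongly_effective G"
    and V: "closedin (unit_space G) V" "invariant G V"
    and F: "finite F" "\<And>B. B \<in> F \<Longrightarrow> compact_open_bisection G B" "\<And>B. B \<in> F \<Longrightarrow> B \<inter> units G = {}"
    and N: "openin (gtop G) N" "N \<subseteq> units G" "N \<inter> V \<noteq> {}"
  obtains M where "openin (gtop G) M" "M \<subseteq> N" "M \<inter> V \<noteq> {}"
    "\<And>a. \<lbrakk>a \<in> \<Union>F; src G a \<in> M \<inter> V\<rbrakk> \<Longrightarrow> rng G a \<noteq> src G a"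
proof -
  have "\<exists>M. openin (gtop G) M \<and> M \<subseteq> N \<and> M \<inter> V \<noteq> {} \<and>
    (\<forall>a\<in>\<Union>F. src G a \<in> M \<inter> V \<longrightarrow> rng G a \<noteq> src G a)"
    using F
  proof (induction F rule: finite_induct)
    case empty
    then show ?case using N by blast
  next
    case (insert B F)
    have B: "compact_open_bisection G B" "B \<inter> units G = {}" using insert.prems by auto
    have IH: "\<exists>M. openin (gtop G) M \<and> M \<subseteq> N \<and> M \<inter> V \<noteq> {} \<and>
      (\<forall>a\<in>\<Union>F. src G a \<in> M \<inter> V \<longrightarrow> rng G a \<noteq> src G a)"
      by (rule insert.IH) (use insert.prems in auto)
    then obtain M where M: "openin (gtop G) M" "M \<subseteq> N" "M \<inter> V \<noteq> {}"
      "\<forall>a\<in>\<Union>F. src G a \<in> M \<inter> V \<longrightarrow> rng G a \<noteq> src G a"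
      by blast
    have oB: "openin (gtop G) B" and BG: "B \<subseteq> arrows G"
      using B openin_subset by (auto simp: compact_open_bisection_def)
    \<comment> \<open>If no arrow of \<open>C\<close> lies over \<open>V\<close>, the set
      \<open>M\<close> already serves for \<open>B\<close> too. Otherwise \<open>M\<close> is shrunk
      once more.\<close>
    define C where "C = B \<inter> {a \<in> arrows G. src G a \<in> M}"
    have C: "openin (gtop G) C" unfolding C_def using oB openin_src_vimage[OF M(1)] by blast
    show ?case
    proof (cases "C \<inter> restr_arrows G V = {}")
      case True
      then have "\<forall>a\<in>B. src G a \<notin> M \<inter> V"
        using BG by (auto simp: C_def restr_arrows_def)
      then show ?thesis using M by (intro exI[of _ M]) auto
    next
      case False
      then obtain a0 where a0: "a0 \<in> C" "a0 \<in> restr_arrows G V" by blast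
      have eff: "effective (restr G V)"
        using se V M(3) unfolding strongly_effective_def by blast
      let ?XV = "subtopology (gtop G) (restr_arrows G V)"
      have "gtop (restr G V) = ?XV" "units (restr G V) = V"
        "isotropy (restr G V) = {a \<in> restr_arrows G V. rng G a = src G a}"
        by (auto simp: restr_def isotropy_def restr_arrows_def)
      then have int: "?XV interior_of {a \<in> restr_arrows G V. rng G a = src G a} = V"
        using eff by (simp add: effective_def)
      have "openin ?XV (restr_arrows G V \<inter> C)"
        using C openin_subtopology_Int2 by blast
      \<comment> \<open>By effectiveness an open set of isotropy arrows over \<open>V\<close> would
        consist of units, but \<open>B\<close> contains none. So some arrow of \<open>C\<close> over
        \<open>V\<close> is not isotropy.\<close>
      moreover have "a0 \<notin> V" using a0(1) B(2) V(2) by (auto simp: C_def invariant_def)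
      ultimately have "\<not> restr_arrows G V \<inter> C \<subseteq> {a \<in> restr_arrows G V. rng G a = src G a}"
        using int a0 interior_of_maximal by blast
      then obtain a where a: "a \<in> C" "a \<in> restr_arrows G V" "rng G a \<noteq> src G a" by blast
      \<comment> \<open>The new open set is the source image of \<open>C'\<close>. Injectivity of
        \<open>src G\<close> on \<open>B\<close> ensures that every arrow of \<open>B\<close>
        starting there belongs to \<open>C'\<close>.\<close>
      define C' where "C' = C \<inter> {a \<in> arrows G. rng G a \<noteq> src G a}"
      have "closedin (gtop G) {a \<in> arrows G. rng G a = src G a}"
        by (rule closedin_continuous_maps_eq[OF Hausdorff continuous_rng' continuous_src'])
      then have "openin (gtop G) (C - {a \<in> arrows G. rng G a = src G a})"
        using C openin_diff by blast
      moreover have "C - {a \<in> arrows G. rng G a = src G a} = C'"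
        unfolding C'_def C_def by blast
      ultimately have "openin (gtop G) (src G ` C')" using openin_src_image by simp
      moreover have "src G ` C' \<subseteq> M" by (auto simp: C'_def C_def)
      moreover have "a \<in> C'" using a BG by (auto simp: C'_def C_def)
      then have "src G ` C' \<inter> V \<noteq> {}" using a(2) by (auto simp: restr_arrows_def)
      moreover have "rng G b \<noteq> src G b" if b: "b \<in> B" "src G b \<in> src G ` C'" for b
      proof -
        obtain c where c: "c \<in> C'" "src G b = src G c" using b by blast
        then have "b = c" using B(1) b(1) unfolding C'_def C_def compact_open_bisection_def inj_on_def by blast
        then show ?thesis using c by (simp add: C'_def)
      qed
      ultimately show ?thesis using M by (intro exI[of _ "src G ` C'"]) blast
    qed
  qed
  then show ?thesis using that by blast
qed

text \<open>Cover \<open>D\<close> by finitely many bisections and apply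
  \<open>avoid_isotropy\<close> to the orbit closure of \<open>u\<close>. The resulting open set
  meets the closure, hence the orbit itself.\<close>

lemma exists_isotropy_free_orbit_point:
  assumes se: "strongly_effective G"
    and D: "compactin (gtop G) D" "openin (gtop G) D" "D \<inter> units G = {}"
    and N: "openin (gtop G) N" "N \<subseteq> units G" "u \<in> N"
  obtains w where "w \<in> N" "w \<in> orbit G u" "\<And>a. \<lbrakk>a \<in> D; src G a = w\<rbrakk> \<Longrightarrow> rng G a \<noteq> w"
proof -
  let ?V = "unit_space G closure_of orbit G u"
  let ?\<B> = "{B. compact_open_bisection G B \<and> B \<subseteq> D}"
  have "D \<subseteq> \<Union>?\<B>"
  proof
    fix a assume "a \<in> D"
    then show "a \<in> \<Union>?\<B>" by (rule compact_open_bisection_ex[OF D(2)]) blast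
  qed
  then have "\<exists>F. finite F \<and> F \<subseteq> ?\<B> \<and> D \<subseteq> \<Union>F"
    by (intro compactinD[OF D(1)]) (auto simp: compact_open_bisection_def)
  then obtain F where F: "finite F" "F \<subseteq> ?\<B>" "D \<subseteq> \<Union>F" by blast
  have sub: "orbit G u \<subseteq> ?V"
    using orbit_subset_units in_orbit_closure by blast
  have "u \<in> orbit G u" using self_in_orbit N by blast
  then have NV: "N \<inter> ?V \<noteq> {}" using sub N by blast
  obtain M where M: "openin (gtop G) M" "M \<subseteq> N" "M \<inter> ?V \<noteq> {}"
    "\<And>a. \<lbrakk>a \<in> \<Union>F; src G a \<in> M \<inter> ?V\<rbrakk> \<Longrightarrow> rng G a \<noteq> src G a"
  proof (rule avoid_isotropy[OF se closedin_closure_of orbit_closure_invariant F(1) _ _ N(1,2) NV])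
    show "compact_open_bisection G B" if "B \<in> F" for B using that F by blast
    show "B \<inter> units G = {}" if "B \<in> F" for B using that F(2) D(3) by blast
  qed blast
  obtain v where v: "v \<in> M" "v \<in> ?V" using M(3) by blast
  have "M \<subseteq> units G" using M N by blast
  then obtain w where w: "w \<in> M" "w \<in> orbit G u"
    using v M(1) in_orbit_closure by blast
  show ?thesis
  proof (rule that[of w])
    show "rng G a \<noteq> w" if "a \<in> D" "src G a = w" for a
    proof -
      have "a \<in> \<Union>F" using that(1) F(3) by blast
      moreover have "src G a \<in> M \<inter> ?V" using that(2) w sub by blast
      ultimately have "rng G a \<noteq> src G a" by (rule M(4))
      then show ?thesis using that(2) by simp
    qed
  qed (use w M in auto)
qed

text \<open>The image of \<open>D\<close> under the pair of range and source is compact, hence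
  closed, and misses \<open>(w, w)\<close>. A box around this point therefore misses it too.\<close>

lemma exists_separating_unit_neighbourhood:
  assumes D: "compactin (gtop G) D"
    and N: "openin (gtop G) N" "N \<subseteq> units G" "w \<in> N"
    and w: "\<And>a. \<lbrakk>a \<in> D; src G a = w\<rbrakk> \<Longrightarrow> rng G a \<noteq> w"
  obtains K where "compactin (gtop G) K" "openin (gtop G) K" "w \<in> K" "K \<subseteq> N"
    "\<And>a. \<lbrakk>a \<in> D; src G a \<in> K\<rbrakk> \<Longrightarrow> rng G a \<notin> K"
proof -
  let ?P = "prod_topology (gtop G) (gtop G)"
  let ?E = "(\<lambda>a. (rng G a, src G a)) ` D"
  have "compactin ?P ?E"
    by (rule image_compactin[OF D]) (simp add: continuous_map_pairedI continuous_rng' continuous_src')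
  moreover have "Hausdorff_space ?P" using Hausdorff by (simp add: Hausdorff_space_prod_topology)
  ultimately have "closedin ?P ?E" using compactin_imp_closedin by blast
  then have oE: "openin ?P (topspace ?P - ?E)" by blast
  moreover have "(w, w) \<in> topspace ?P - ?E" using w N units_subset by auto
  ultimately obtain X Y where XY: "openin (gtop G) X" "openin (gtop G) Y" "w \<in> X" "w \<in> Y"
    "X \<times> Y \<subseteq> topspace ?P - ?E"
    using oE[unfolded openin_prod_topology_alt, THEN spec, THEN spec, THEN mp, of w w] by blast
  have "openin (gtop G) (X \<inter> Y \<inter> N)" using XY N by blast
  then obtain K where K: "compact_open_bisection G K" "w \<in> K" "K \<subseteq> X \<inter> Y \<inter> N"
    using compact_open_bisection_ex[of "X \<inter> Y \<inter> N" w] XY N by blast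
  show ?thesis
  proof (rule that[of K])
    show "rng G a \<notin> K" if "a \<in> D" "src G a \<in> K" for a
    proof
      assume "rng G a \<in> K"
      then have "(rng G a, src G a) \<in> X \<times> Y" using K that by blast
      then show False using XY(5) that by blast
    qed
  qed (use K in \<open>auto simp: compact_open_bisection_def\<close>)
qed

end

section \<open>Ideals and their fibres\<close>

text \<open>Since one \<open>W\<close> serves all of its points, the units whose fibre contains a
  given scalar form an open set.\<close>

definition fibre_ideal ::
    "'a groupoid \<Rightarrow> ('a \<Rightarrow> 'r::{comm_ring, comm_monoid_mult}) set \<Rightarrow> 'a \<Rightarrow> 'r set" where
  "fibre_ideal G I u = {r. \<exists>W. compactin (gtop G) W \<and> openin (gtop G) W \<and> W \<subseteq> units G \<and> u \<in> W \<and>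
    scale_fun r (char_fun W) \<in> I}"

text \<open>The family is pulled back along the source map; for families constant on orbits the
  range map imposes the same condition.\<close>

definition sections ::
    "'a groupoid \<Rightarrow> ('a \<Rightarrow> 'r::{comm_ring, comm_monoid_mult} set) \<Rightarrow> ('a \<Rightarrow> 'r) set" where
  "sections G J = {f \<in> steinberg G. \<forall>a \<in> arrows G. f a \<in> J (src G a)}"

context ample_Hausdorff_groupoid
begin

section \<open>Moving scalar multiples of characteristic functions within an ideal\<close>

context
  fixes I :: "('a \<Rightarrow> 'r::{comm_ring, comm_monoid_mult}) set"
  assumes I: "I \<in> steinberg_ideals G"
begin

lemma ideal_steinberg: "f \<in> I \<Longrightarrow> f \<in> steinberg G"
  using I by (auto simp: steinberg_ideals_def)

lemma ideal_zero: "(\<lambda>a. 0) \<in> I"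
  using I by (simp add: steinberg_ideals_def)

lemma ideal_add: "f \<in> I \<Longrightarrow> g \<in> I \<Longrightarrow> (\<lambda>a. f a + g a) \<in> I"
  using I by (simp add: steinberg_ideals_def)

lemma ideal_convolution_left: "f \<in> I \<Longrightarrow> g \<in> steinberg G \<Longrightarrow> convolution G g f \<in> I"
  using I by (simp add: steinberg_ideals_def)

lemma ideal_convolution_right: "f \<in> I \<Longrightarrow> g \<in> steinberg G \<Longrightarrow> convolution G f g \<in> I"
  using I by (simp add: steinberg_ideals_def)

lemma ideal_restrict_src:
  assumes W: "W \<subseteq> units G" "scale_fun r (char_fun W) \<in> I"
    and B: "compact_open_bisection G B" "src G ` B \<subseteq> W"
  shows "scale_fun r (char_fun B) \<in> I"
proof -
  have st: "char_fun B \<in> (steinberg G :: ('a \<Rightarrow> 'r) set)"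
    using B by (simp add: steinberg_char compact_open_bisection_def)
  have "convolution G (char_fun B) (scale_fun r (char_fun W)) \<in> I"
    using ideal_convolution_left W st by blast
  also have "convolution G (char_fun B) (scale_fun r (char_fun W)) = scale_fun r (char_fun B)"
    unfolding convolution_units_right[OF W(1) st]
    using B(2) by (auto simp: fun_eq_iff scale_fun_def char_fun_def)
  finally show ?thesis .
qed

lemma ideal_restrict_rng:
  assumes W: "W \<subseteq> units G" "scale_fun r (char_fun W) \<in> I"
    and B: "compact_open_bisection G B" "rng G ` B \<subseteq> W"
  shows "scale_fun r (char_fun B) \<in> I"
proof -
  have st: "char_fun B \<in> (steinberg G :: ('a \<Rightarrow> 'r) set)"
    using B by (simp add: steinberg_char compact_open_bisection_def)
  have "convolution G (scale_fun r (char_fun W)) (char_fun B) \<in> I"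
    using ideal_convolution_right W st by blast
  also have "convolution G (scale_fun r (char_fun W)) (char_fun B) = scale_fun r (char_fun B)"
    unfolding convolution_units_left[OF W(1) st]
    using B(2) by (auto simp: fun_eq_iff scale_fun_def char_fun_def)
  finally show ?thesis .
qed

text \<open>Scaling is realised inside the algebra, as convolution with \<open>c\<close> times the
  local unit 1_B.\<close>

lemma ideal_scale_char:
  assumes B: "compactin (gtop G) B" "openin (gtop G) B" "B \<subseteq> units G"
    and r: "scale_fun r (char_fun B) \<in> I"
  shows "scale_fun (c * r) (char_fun B) \<in> I"
proof -
  have "convolution G (scale_fun c (char_fun B)) (scale_fun r (char_fun B)) \<in> I"
    using ideal_convolution_left[OF r] steinberg_scale steinberg_char B by blast
  also have "convolution G (scale_fun c (char_fun B)) (scale_fun r (char_fun B)) =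
    scale_fun (c * r) (char_fun B)"
    unfolding convolution_units_left[OF B(3) ideal_steinberg[OF r]]
    using B(3) rng_unit by (auto simp: fun_eq_iff scale_fun_def char_fun_def mult.assoc)
  finally show ?thesis .
qed

text \<open>The product of the inverse of a bisection with the bisection is its source image, so
  left convolution with the inverse bisection gives the claim.\<close>

lemma ideal_char_src:
  assumes B: "compact_open_bisection G B" and r: "scale_fun r (char_fun B) \<in> I"
  shows "scale_fun r (char_fun (src G ` B)) \<in> I"
proof -
  let ?C = "ginv G ` B"
  have C: "compact_open_bisection G ?C" using compact_open_bisection_ginv[OF B] .
  have BG: "B \<subseteq> arrows G" using B openin_subset by (auto simp: compact_open_bisection_def)
  have CG: "?C \<subseteq> arrows G" using C openin_subset by (auto simp: compact_open_bisection_def)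
  have "convolution G (scale_fun 1 (char_fun ?C)) (scale_fun r (char_fun B)) \<in> I"
    using ideal_convolution_left[OF r] steinberg_scale_char[OF C] by blast
  also have "convolution G (scale_fun 1 (char_fun ?C)) (scale_fun r (char_fun B)) =
    scale_fun r (char_fun (src G ` B))"
  proof
    fix a
    show "convolution G (scale_fun 1 (char_fun ?C)) (scale_fun r (char_fun B)) a =
      scale_fun r (char_fun (src G ` B)) a"
    proof (cases "a \<in> arrows G \<and> rng G a \<in> rng G ` ?C")
      case True
      then obtain b where b: "b \<in> B" "rng G (ginv G b) = rng G a" and a: "a \<in> arrows G"
        by auto
      have b': "b \<in> arrows G" using b BG by blast
      have sb: "src G b = rng G a" using b b' by (simp add: rng_ginv)
      have "convolution G (scale_fun 1 (char_fun ?C)) (scale_fun r (char_fun B)) a =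
        1 * scale_fun r (char_fun B) (comp G (ginv G (ginv G b)) a)"
        by (rule convolution_char_left)
          (use C CG a b in \<open>auto simp: compact_open_bisection_def\<close>)
      also have "\<dots> = scale_fun r (char_fun B) (comp G b a)" using b' by (simp add: ginv_ginv)
      also have "\<dots> = scale_fun r (char_fun (src G ` B)) a"
      proof -
        \<comment> \<open>The composite has the range of \<open>b\<close>. If it lies in
          \<open>B\<close>, injectivity of \<open>rng G\<close> makes it equal to \<open>b\<close>,
          so \<open>a\<close> is the unit \<open>src G b\<close>.\<close>
        have "comp G b a \<in> B \<longleftrightarrow> a \<in> src G ` B"
        proof
          assume "comp G b a \<in> B"
          moreover have ba: "(b, a) \<in> composable G" using b' a sb by (simp add: composable_def)
          ultimately have "comp G b a = b"
            using B b(1) rng_comp[OF ba] by (auto simp: compact_open_bisection_def inj_on_def)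
          then have "comp G (ginv G b) (comp G b a) = src G b"
            using comp_ginv_left b' by simp
          moreover have "comp G (ginv G b) (comp G b a) = a"
            using comp_assoc[of "ginv G b" b a] ba b' a sb
            by (simp add: composable_def ginv_in src_ginv comp_ginv_left comp_unit_left)
          ultimately show "a \<in> src G ` B" using b(1) by auto
        next
          assume "a \<in> src G ` B"
          then have "a = src G b" using sb BG src_in rng_unit by auto
          then show "comp G b a \<in> B" using b(1) b' by (simp add: comp_unit_right)
        qed
        then show ?thesis by (simp add: scale_fun_def char_fun_def)
      qed
      finally show ?thesis .
    next
      case False
      then have "convolution G (scale_fun 1 (char_fun ?C)) (scale_fun r (char_fun B)) a = 0"
        using convolution_outside convolution_char_left_zero by metis
      moreover have "a \<notin> src G ` B"
      proof
        assume "a \<in> src G ` B"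
        then obtain b where "b \<in> B" "a = src G b" by blast
        then have "a \<in> arrows G" "rng G a = rng G (ginv G b)"
          using BG by (auto simp: rng_ginv rng_src src_arrow)
        then show False using False \<open>b \<in> B\<close> by blast
      qed
      ultimately show ?thesis by (simp add: scale_fun_def char_fun_def)
    qed
  qed
  finally show ?thesis .
qed

section \<open>An ideal is determined by its fibres\<close>

lemma unit_value_in_fibre_ideal:
  assumes se: "strongly_effective G" and f: "f \<in> I" and u: "u \<in> units G"
  shows "f u \<in> fibre_ideal G I u"
proof -
  let ?r = "f u"
  have fs: "f \<in> steinberg G" using ideal_steinberg f by blast
  \<comment> \<open>Removing the clopen unit space leaves a compact open set of non-units, as the
    avoidance of isotropy requires.\<close>
  let ?D = "supp f - units G"
  let ?N = "units G \<inter> {a \<in> arrows G. f a = ?r}"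
  have lc: "locally_constant G f" using steinberg_locally_constant fs by blast
  have "supp f = {a \<in> arrows G. f a \<noteq> 0}" using fs by (auto simp: steinberg_def supp_def)
  then have "openin (gtop G) (supp f)"
    using locally_constant_level[OF lc, where P = "\<lambda>y. y \<noteq> 0"] by simp
  then have oD: "openin (gtop G) ?D" using closedin_units openin_diff by blast
  have "closedin (gtop G) ?D"
    using supp_closedin[OF lc] fs openin_units by (auto simp: steinberg_def intro: closedin_diff)
  then have cD: "compactin (gtop G) ?D"
    using closed_compactin[OF steinberg_compact_supp[OF fs], of ?D] by blast
  have oN: "openin (gtop G) ?N"
    using openin_Int[OF openin_units locally_constant_level[OF lc, where P = "\<lambda>y. y = ?r"]] .
  have uN: "u \<in> ?N" using u units_subset by blast
  obtain w where w: "w \<in> ?N" "w \<in> orbit G u" "\<And>a. \<lbrakk>a \<in> ?D; src G a = w\<rbrakk> \<Longrightarrow> rng G a \<noteq> w"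
    using exists_isotropy_free_orbit_point[OF se cD oD _ oN _ uN] by blast
  obtain K where K: "compactin (gtop G) K" "openin (gtop G) K" "w \<in> K" "K \<subseteq> ?N"
    and sep: "\<And>a. \<lbrakk>a \<in> ?D; src G a \<in> K\<rbrakk> \<Longrightarrow> rng G a \<notin> K"
    using exists_separating_unit_neighbourhood[OF cD oN _ w(1,3)] by blast
  have Ku: "K \<subseteq> units G" using K by blast
  have chK: "scale_fun 1 (char_fun K) \<in> (steinberg G :: ('a \<Rightarrow> 'r) set)"
    using steinberg_scale steinberg_char K by blast
  have fK: "convolution G f (scale_fun 1 (char_fun K)) \<in> I"
    using ideal_convolution_right f chK by blast
  have "convolution G (scale_fun 1 (char_fun K)) (convolution G f (scale_fun 1 (char_fun K))) \<in> I"
    using ideal_convolution_left[OF fK chK] .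
  also have "convolution G (scale_fun 1 (char_fun K)) (convolution G f (scale_fun 1 (char_fun K))) =
    scale_fun ?r (char_fun K)"
    unfolding convolution_units_left[OF Ku ideal_steinberg[OF fK]]
    unfolding convolution_units_right[OF Ku fs]
  proof
    fix a
    \<comment> \<open>A unit outside \<open>K\<close> has its range outside \<open>K\<close>, and an
      arrow of \<open>?D\<close> cannot have both ends in \<open>K\<close> by \<open>sep\<close>.
      Only \<open>K\<close> itself survives, where \<open>f\<close> is constant.\<close>
    consider "a \<in> K" | "a \<notin> K" "a \<in> units G" | "a \<in> ?D" | "f a = 0" "a \<notin> K"
      by (auto simp: supp_def)
    then show "(if rng G a \<in> K then 1 * (if src G a \<in> K then f a * 1 else 0) else 0) =
      scale_fun ?r (char_fun K) a"
    proof cases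
      case 1
      then have "a \<in> units G" "f a = ?r" using K by auto
      then show ?thesis using 1 by (simp add: rng_unit src_unit scale_fun_def char_fun_def)
    next
      case 2
      then show ?thesis by (simp add: rng_unit scale_fun_def char_fun_def)
    next
      case 3
      then have "a \<notin> K" using Ku by blast
      then show ?thesis using sep[OF 3] by (simp add: scale_fun_def char_fun_def)
    next
      case 4
      then show ?thesis by (simp add: scale_fun_def char_fun_def)
    qed
  qed
  finally have rK: "scale_fun ?r (char_fun K) \<in> I" .
  \<comment> \<open>The scalar is now transported from \<open>w\<close> back to \<open>u\<close>: a
    bisection \<open>B\<close> through \<open>g\<close> with range in \<open>K\<close> inherits
    membership, and so does its source image, which contains \<open>u\<close>.\<close>
  obtain g where g: "g \<in> arrows G" "src G g = u" "rng G g = w"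
    using w(2) by (auto simp: orbit_def)
  obtain B where B: "compact_open_bisection G B" "g \<in> B" "B \<subseteq> {a \<in> arrows G. rng G a \<in> K}"
    using compact_open_bisection_ex[OF openin_rng_vimage[OF K(2)], of g] g K(3) by blast
  have "scale_fun ?r (char_fun B) \<in> I"
    by (rule ideal_restrict_rng[OF Ku rK B(1)]) (use B(3) in blast)
  then have "scale_fun ?r (char_fun (src G ` B)) \<in> I"
    using ideal_char_src B(1) by blast
  moreover have "compact_open_bisection G (src G ` B)" using compact_open_bisection_src B(1) by blast
  moreover have "src G ` B \<subseteq> units G" using B(3) src_in by blast
  moreover have "u \<in> src G ` B" using g(2) B(2) by blast
  ultimately show ?thesis unfolding fibre_ideal_def compact_open_bisection_def by blast
qed

text \<open>Left translation by a bisection through the inverse of \<open>a\<close> moves the value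
  \<open>f a\<close> to the unit \<open>src G a\<close>.\<close>

lemma value_in_fibre_ideal:
  assumes se: "strongly_effective G" and f: "f \<in> I" and a: "a \<in> arrows G"
  shows "f a \<in> fibre_ideal G I (src G a)"
proof -
  obtain B where B: "compact_open_bisection G B" "ginv G a \<in> B"
    using ginv_in[OF a] by (auto intro: compact_open_bisection_ex[OF openin_topspace])
  have BG: "B \<subseteq> arrows G" using B openin_subset by (auto simp: compact_open_bisection_def)
  let ?h = "convolution G (scale_fun 1 (char_fun B)) f"
  have "?h \<in> I" by (rule ideal_convolution_left[OF f steinberg_scale_char[OF B(1)]])
  then have "?h (src G a) \<in> fibre_ideal G I (src G a)"
    by (rule unit_value_in_fibre_ideal[OF se _ src_in[OF a]])
  also have "?h (src G a) = 1 * f (comp G (ginv G (ginv G a)) (src G a))"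
    by (rule convolution_char_left)
      (use B BG a in \<open>auto simp: compact_open_bisection_def rng_ginv rng_src src_arrow\<close>)
  also have "\<dots> = f a" using a by (simp add: ginv_ginv comp_unit_right)
  finally show ?thesis .
qed

text \<open>One inclusion is \<open>value_in_fibre_ideal\<close>. The other is local: near
  \<open>a\<close>, multiplying by \<open>f a\<close> times 1_W puts \<open>f a\<close> times the
  characteristic function of every small bisection into \<open>I\<close>.\<close>

lemma ideal_eq_sections:
  assumes se: "strongly_effective G"
  shows "I = sections G (fibre_ideal G I)"
proof
  show "I \<subseteq> sections G (fibre_ideal G I)"
    using value_in_fibre_ideal[OF se] ideal_steinberg by (auto simp: sections_def)
  show "sections G (fibre_ideal G I) \<subseteq> I"
  proof
    fix f assume "f \<in> sections G (fibre_ideal G I)"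
    then have f: "f \<in> steinberg G" "\<And>a. a \<in> arrows G \<Longrightarrow> f a \<in> fibre_ideal G I (src G a)"
      by (auto simp: sections_def)
    show "f \<in> I"
    proof (rule steinberg_local_membership[OF f(1) ideal_zero ideal_add])
      fix a assume a: "a \<in> arrows G"
      obtain W where W: "openin (gtop G) W" "W \<subseteq> units G" "src G a \<in> W" "scale_fun (f a) (char_fun W) \<in> I"
        using f(2)[OF a] by (auto simp: fibre_ideal_def)
      show "\<exists>N. openin (gtop G) N \<and> a \<in> N \<and>
        (\<forall>B. compact_open_bisection G B \<and> B \<subseteq> N \<longrightarrow> scale_fun (f a) (char_fun B) \<in> I)"
      proof (intro exI conjI allI impI)
        show "openin (gtop G) {b \<in> arrows G. src G b \<in> W}" using openin_src_vimage[OF W(1)] .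
        show "a \<in> {b \<in> arrows G. src G b \<in> W}" using a W(3) by blast
        fix B assume "compact_open_bisection G B \<and> B \<subseteq> {b \<in> arrows G. src G b \<in> W}"
        then show "scale_fun (f a) (char_fun B) \<in> I"
          by (intro ideal_restrict_src[OF W(2,4)]) auto
      qed
    qed
  qed
qed

text \<open>A bisection \<open>B\<close> through the inverse of \<open>a\<close>, with range in
  \<open>W\<close>, has \<open>r\<close> times its characteristic function in \<open>I\<close>. The
  value \<open>r\<close> of this function at the inverse of \<open>a\<close> lies in the fibre over
  \<open>rng G a\<close>.\<close>

lemma fibre_ideal_invariant:
  assumes se: "strongly_effective G" and a: "a \<in> arrows G" and r: "r \<in> fibre_ideal G I (src G a)"
  shows "r \<in> fibre_ideal G I (rng G a)"
proof -
  obtain W where W: "openin (gtop G) W" "W \<subseteq> units G" "src G a \<in> W" "scale_fun r (char_fun W) \<in> I"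
    using r by (auto simp: fibre_ideal_def)
  have "openin (gtop G) {b \<in> arrows G. rng G b \<in> W}" "ginv G a \<in> {b \<in> arrows G. rng G b \<in> W}"
    using openin_rng_vimage W a by (auto simp: ginv_in rng_ginv)
  then obtain B where B: "compact_open_bisection G B" "ginv G a \<in> B" "B \<subseteq> {b \<in> arrows G. rng G b \<in> W}"
    using compact_open_bisection_ex by blast
  have "scale_fun r (char_fun B) \<in> I"
    by (rule ideal_restrict_rng[OF W(2,4) B(1)]) (use B(3) in blast)
  then have "scale_fun r (char_fun B) (ginv G a) \<in> fibre_ideal G I (src G (ginv G a))"
    using value_in_fibre_ideal[OF se] ginv_in[OF a] by blast
  then show ?thesis using B(2) a by (simp add: scale_fun_def char_fun_def src_ginv)
qed

end

end

section \<open>The correspondence\<close>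

text \<open>For \<open>\<pi>\<close> in \<open>ideal_functions G\<close> this is a directed union:
  the ideals grow as the sets shrink, and two open invariant sets containing \<open>u\<close> have
  one inside both.\<close>

definition stalk ::
    "'a groupoid \<Rightarrow> ('a set \<Rightarrow> 'r::{comm_ring, comm_monoid_mult} set) \<Rightarrow> 'a \<Rightarrow> 'r set" where
  "stalk G \<pi> u = {r. \<exists>U \<in> open_invariants G. u \<in> U \<and> r \<in> \<pi> U}"

definition span_ideal ::
    "'a groupoid \<Rightarrow> ('a set \<Rightarrow> 'r::{comm_ring, comm_monoid_mult} set) \<Rightarrow> ('a \<Rightarrow> 'r) set" where
  "span_ideal G \<pi> = fun_span (\<Union>U \<in> open_invariants G.
    {scale_fun r f | r f. r \<in> \<pi> U \<and> f \<in> steinberg G \<and> supp f \<subseteq> restr_arrows G U})"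

text \<open>The candidate inverse of \<open>span_ideal\<close>. Restriction to
  \<open>open_invariants G\<close> fixes the value \<open>undefined\<close> elsewhere, as the
  extensional function space in \<open>ideal_functions\<close> demands.\<close>

definition scalar_function ::
    "'a groupoid \<Rightarrow> ('a \<Rightarrow> 'r::{comm_ring, comm_monoid_mult}) set \<Rightarrow> 'a set \<Rightarrow> 'r set" where
  "scalar_function G I = (\<lambda>U \<in> open_invariants G.
    {r. \<forall>B. compactin (gtop G) B \<and> openin (gtop G) B \<and> B \<subseteq> U \<longrightarrow> scale_fun r (char_fun B) \<in> I})"

lemma ring_ideal_sum:
  assumes "J \<in> ring_ideals" "\<And>i. i \<in> S \<Longrightarrow> h i \<in> J"
  shows "(\<Sum>i\<in>S. h i) \<in> (J :: 'r::{comm_ring, comm_monoid_mult} set)"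
  using assms by (induction S rule: infinite_finite_induct) (auto simp: ring_ideals_def)

lemma fun_span_zero: "(\<lambda>a. 0) \<in> fun_span S"
  unfolding fun_span_def by (intro CollectI exI[of _ "{}"]) simp

lemma fun_span_base: "f \<in> S \<Longrightarrow> f \<in> fun_span S"
  unfolding fun_span_def
  by (intro CollectI exI[of _ "{f}"] exI[of _ "\<lambda>_. 1"]) (simp add: scale_fun_def)

lemma fun_span_add:
  fixes f g :: "'a \<Rightarrow> 'r::{comm_ring, comm_monoid_mult}"
  assumes "f \<in> fun_span S" "g \<in> fun_span S"
  shows "(\<lambda>a. f a + g a) \<in> fun_span S"
proof -
  obtain T c where T: "finite T" "T \<subseteq> S" "f = (\<lambda>a. \<Sum>h\<in>T. scale_fun (c h) h a)"
    using assms(1) by (auto simp: fun_span_def)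
  obtain T' c' where T': "finite T'" "T' \<subseteq> S" "g = (\<lambda>a. \<Sum>h\<in>T'. scale_fun (c' h) h a)"
    using assms(2) by (auto simp: fun_span_def)
  \<comment> \<open>The sets \<open>T\<close> and \<open>T'\<close> may overlap, so both coefficient
    functions are extended by zero to the union before they are added.\<close>
  define d where "d h = (if h \<in> T then c h else 0) + (if h \<in> T' then c' h else 0)" for h
  have "f a + g a = (\<Sum>h\<in>T \<union> T'. scale_fun (d h) h a)" for a
  proof -
    have "f a = (\<Sum>h\<in>T \<union> T'. scale_fun (if h \<in> T then c h else 0) h a)"
      unfolding T(3) using T T'
      by (intro sum.mono_neutral_cong_left) (auto simp: scale_fun_def)
    moreover have "g a = (\<Sum>h\<in>T \<union> T'. scale_fun (if h \<in> T' then c' h else 0) h a)"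
      unfolding T'(3) using T T'
      by (intro sum.mono_neutral_cong_left) (auto simp: scale_fun_def)
    ultimately show ?thesis
      by (simp add: d_def scale_fun_def distrib_right sum.distrib)
  qed
  then show ?thesis
    unfolding fun_span_def using T T'
    by (intro CollectI exI[of _ "T \<union> T'"] exI[of _ d]) auto
qed

lemma fun_span_least:
  assumes "S \<subseteq> M" "(\<lambda>a. 0) \<in> M" "\<And>f g. \<lbrakk>f \<in> M; g \<in> M\<rbrakk> \<Longrightarrow> (\<lambda>a. f a + g a) \<in> M"
    and "\<And>c f. f \<in> M \<Longrightarrow> scale_fun c f \<in> M"
  shows "fun_span S \<subseteq> M"
proof
  fix f assume "f \<in> fun_span S"
  then obtain T c where T: "finite T" "T \<subseteq> S" "f = (\<lambda>a. \<Sum>h\<in>T. scale_fun (c h) h a)"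
    by (auto simp: fun_span_def)
  have "(\<lambda>a. \<Sum>h\<in>T. scale_fun (c h) h a) \<in> M"
    using T(1,2)
  proof (induction T rule: finite_induct)
    case empty
    then show ?case using assms(2) by simp
  next
    case (insert h T)
    have "scale_fun (c h) h \<in> M" using insert assms(1,4) by blast
    then show ?case using insert assms(3)[of "scale_fun (c h) h"] by simp
  qed
  then show "f \<in> M" using T(3) by simp
qed

context ample_Hausdorff_groupoid
begin

section \<open>Open invariant sets\<close>

lemma open_invariants_iff:
  "U \<in> open_invariants G \<longleftrightarrow> U \<noteq> {} \<and> openin (gtop G) U \<and> invariant G U"
  unfolding open_invariants_def by (auto simp: openin_unit_space invariant_def)

lemma open_invariant_subset_units: "U \<in> open_invariants G \<Longrightarrow> U \<subseteq> units G"
  by (auto simp: open_invariants_iff invariant_def)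

lemma open_invariant_rng_iff:
  assumes "U \<in> open_invariants G" "a \<in> arrows G"
  shows "rng G a \<in> U \<longleftrightarrow> src G a \<in> U"
proof
  assume "rng G a \<in> U"
  then have "src G (ginv G a) \<in> U" using assms by (simp add: src_ginv)
  then have "rng G (ginv G a) \<in> U"
    using assms ginv_in by (auto simp: open_invariants_iff invariant_def)
  then show "src G a \<in> U" using assms by (simp add: rng_ginv)
qed (use assms in \<open>auto simp: open_invariants_iff invariant_def\<close>)

lemma open_invariants_units: "units G \<noteq> {} \<Longrightarrow> units G \<in> open_invariants G"
  by (simp add: open_invariants_iff openin_units invariant_def rng_in)

lemma open_invariants_Int:
  assumes "U \<in> open_invariants G" "U' \<in> open_invariants G" "u \<in> U" "u \<in> U'"
  shows "U \<inter> U' \<in> open_invariants G"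
  using assms by (auto simp: open_invariants_iff invariant_def)

lemma open_invariants_Union:
  assumes "\<A> \<subseteq> open_invariants G" "\<A> \<noteq> {}"
  shows "\<Union>\<A> \<in> open_invariants G"
proof -
  have "openin (gtop G) (\<Union>\<A>)"
    using assms(1) open_invariants_iff by (blast intro: openin_Union)
  moreover have "invariant G (\<Union>\<A>)"
    using assms(1) by (fastforce simp: open_invariants_iff invariant_def)
  moreover have "\<Union>\<A> \<noteq> {}" using assms by (auto simp: open_invariants_iff)
  ultimately show ?thesis by (simp add: open_invariants_iff)
qed

section \<open>From functions on open invariant sets to ideals\<close>

context
  fixes \<pi> :: "'a set \<Rightarrow> 'r::{comm_ring, comm_monoid_mult} set"
  assumes \<pi>: "\<pi> \<in> ideal_functions G"
begin

lemma ideal_function_ideal: "U \<in> open_invariants G \<Longrightarrow> \<pi> U \<in> ring_ideals"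
  using \<pi> by (auto simp: ideal_functions_def)

lemma ideal_function_Union:
  "\<lbrakk>\<A> \<subseteq> open_invariants G; \<A> \<noteq> {}\<rbrakk> \<Longrightarrow> \<pi> (\<Union>\<A>) = (\<Inter>U \<in> \<A>. \<pi> U)"
  using \<pi> by (auto simp: ideal_functions_def)

text \<open>The union of \<open>U\<close> and the larger \<open>U'\<close> is \<open>U'\<close>, so
  the union condition expresses \<open>\<pi> U'\<close> as an intersection with
  \<open>\<pi> U\<close>.\<close>

lemma ideal_function_antimono:
  assumes "U \<in> open_invariants G" "U' \<in> open_invariants G" "U \<subseteq> U'"
  shows "\<pi> U' \<subseteq> \<pi> U"
proof -
  have "\<pi> (\<Union>{U, U'}) = \<pi> U \<inter> \<pi> U'"
    using ideal_function_Union[of "{U, U'}"] assms by simp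
  moreover have "\<Union>{U, U'} = U'" using assms by auto
  ultimately show ?thesis by auto
qed

lemma stalk_ideal:
  assumes "u \<in> units G"
  shows "stalk G \<pi> u \<in> ring_ideals"
  unfolding ring_ideals_def
proof (intro CollectI conjI ballI allI)
  have U: "units G \<in> open_invariants G" using assms open_invariants_units by blast
  then have "0 \<in> \<pi> (units G)" using ideal_function_ideal by (auto simp: ring_ideals_def)
  then show "0 \<in> stalk G \<pi> u" using U assms by (auto simp: stalk_def)
  fix x assume "x \<in> stalk G \<pi> u"
  then obtain U where U: "U \<in> open_invariants G" "u \<in> U" "x \<in> \<pi> U" by (auto simp: stalk_def)
  show "c * x \<in> stalk G \<pi> u" for c
    using U ideal_function_ideal[OF U(1)] by (auto simp: stalk_def ring_ideals_def)
  fix y assume "y \<in> stalk G \<pi> u"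
  then obtain U' where U': "U' \<in> open_invariants G" "u \<in> U'" "y \<in> \<pi> U'" by (auto simp: stalk_def)
  \<comment> \<open>Both scalars lie in the larger ideal attached to the intersection, where they
    can be added.\<close>
  have I: "U \<inter> U' \<in> open_invariants G" using open_invariants_Int[OF U(1) U'(1) U(2) U'(2)] .
  have "x \<in> \<pi> (U \<inter> U')" "y \<in> \<pi> (U \<inter> U')"
    using ideal_function_antimono[OF I] U U' by auto
  then have "x + y \<in> \<pi> (U \<inter> U')" using ideal_function_ideal[OF I] by (auto simp: ring_ideals_def)
  then show "x + y \<in> stalk G \<pi> u" using I U U' by (auto simp: stalk_def)
qed

lemma stalk_rng:
  assumes "a \<in> arrows G"
  shows "stalk G \<pi> (rng G a) = stalk G \<pi> (src G a)"
  using open_invariant_rng_iff[OF _ assms] by (auto simp: stalk_def)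

lemma sections_stalk_add:
  assumes "f \<in> sections G (stalk G \<pi>)" "g \<in> sections G (stalk G \<pi>)"
  shows "(\<lambda>a. f a + g a) \<in> sections G (stalk G \<pi>)"
  using assms stalk_ideal src_in by (fastforce simp: sections_def steinberg_add ring_ideals_def)

lemma sections_stalk_scale:
  assumes "f \<in> sections G (stalk G \<pi>)"
  shows "scale_fun c f \<in> sections G (stalk G \<pi>)"
proof -
  have "c * f a \<in> stalk G \<pi> (src G a)" if "a \<in> arrows G" for a
    using assms that stalk_ideal[OF src_in[OF that]] by (simp add: sections_def ring_ideals_def)
  then show ?thesis using assms by (simp add: sections_def steinberg_scale scale_fun_def[of c f]
        steinberg_scale[unfolded scale_fun_def])
qed

lemma sections_stalk_zero: "(\<lambda>a. 0) \<in> sections G (stalk G \<pi>)"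
  using stalk_ideal src_in by (fastforce simp: sections_def steinberg_zero ring_ideals_def)

lemma sections_stalk_steinberg_ideal: "sections G (stalk G \<pi>) \<in> steinberg_ideals G"
  unfolding steinberg_ideals_def
proof (intro CollectI conjI ballI)
  show "sections G (stalk G \<pi>) \<subseteq> steinberg G" by (auto simp: sections_def)
  show "(\<lambda>a. 0) \<in> sections G (stalk G \<pi>)" by (rule sections_stalk_zero)
  fix f assume f: "f \<in> sections G (stalk G \<pi>)"
  then have fs: "f \<in> steinberg G" and fa: "\<And>a. a \<in> arrows G \<Longrightarrow> f a \<in> stalk G \<pi> (src G a)"
    by (auto simp: sections_def)
  show "(\<lambda>a. f a + g a) \<in> sections G (stalk G \<pi>)" if "g \<in> sections G (stalk G \<pi>)" for g
    using sections_stalk_add f that by blast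
  have "scale_fun (- 1) f = (\<lambda>a. - f a)"
    by (simp add: scale_fun_def flip: minus_mult_left)
  then show "(\<lambda>a. - f a) \<in> sections G (stalk G \<pi>)"
    using sections_stalk_scale[OF f, of "- 1"] by simp
  fix g assume g: "g \<in> (steinberg G :: ('a \<Rightarrow> 'r) set)"
  have "convolution G g f a \<in> stalk G \<pi> (src G a)" if a: "a \<in> arrows G" for a
  proof -
    have J: "stalk G \<pi> (src G a) \<in> ring_ideals" using stalk_ideal src_in a by blast
    have "g b * f (comp G (ginv G b) a) \<in> stalk G \<pi> (src G a)"
      if "b \<in> arrows G" "rng G b = rng G a" for b
    proof -
      have "f (comp G (ginv G b) a) \<in> stalk G \<pi> (src G a)"
        using fa[OF ginv_comp_in[OF a that]] src_ginv_comp[OF a that] by simp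
      then show ?thesis using J by (simp add: ring_ideals_def)
    qed
    then show ?thesis using a unfolding convolution_def by (auto intro: ring_ideal_sum[OF J])
  qed
  then show "convolution G g f \<in> sections G (stalk G \<pi>)"
    using steinberg_convolution[OF g fs] by (simp add: sections_def)
  have "convolution G f g a \<in> stalk G \<pi> (src G a)" if a: "a \<in> arrows G" for a
  proof -
    have J: "stalk G \<pi> (src G a) \<in> ring_ideals" using stalk_ideal src_in a by blast
    have "f b * g (comp G (ginv G b) a) \<in> stalk G \<pi> (src G a)"
      if "b \<in> arrows G" "rng G b = rng G a" for b
    proof -
      \<comment> \<open>The value \<open>f b\<close> belongs to the stalk at \<open>src G b\<close>.
        Invariance of stalks carries it through the common range of \<open>b\<close> and
        \<open>a\<close> to \<open>src G a\<close>.\<close>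
      have "f b \<in> stalk G \<pi> (src G a)"
        using fa[OF that(1)] stalk_rng[OF that(1)] stalk_rng[OF a] that(2) by simp
      then show ?thesis using J by (simp add: ring_ideals_def mult.commute[of "f b"])
    qed
    then show ?thesis using a unfolding convolution_def by (auto intro: ring_ideal_sum[OF J])
  qed
  then show "convolution G f g \<in> sections G (stalk G \<pi>)"
    using steinberg_convolution[OF fs g] by (simp add: sections_def)
qed

text \<open>A generator \<open>r f\<close> can be nonzero only at arrows with source in
  \<open>U\<close>, where \<open>r\<close> lies in the stalk. Conversely, the set \<open>U\<close>
  witnessing that \<open>f a\<close> is in the stalk makes \<open>f a\<close> times the
  characteristic function of any compact open bisection over \<open>U\<close> a generator.\<close>

lemma span_ideal_eq_sections: "span_ideal G \<pi> = sections G (stalk G \<pi>)"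
proof
  show "span_ideal G \<pi> \<subseteq> sections G (stalk G \<pi>)"
    unfolding span_ideal_def
  proof (rule fun_span_least)
    show "(\<Union>U \<in> open_invariants G. {scale_fun r f | r f. r \<in> \<pi> U \<and> f \<in> steinberg G \<and>
      supp f \<subseteq> restr_arrows G U}) \<subseteq> sections G (stalk G \<pi>)"
    proof clarify
      fix U r and f :: "'a \<Rightarrow> 'r"
      assume U: "U \<in> open_invariants G" "r \<in> \<pi> U" "f \<in> steinberg G" "supp f \<subseteq> restr_arrows G U"
      have "r * f a \<in> stalk G \<pi> (src G a)" if a: "a \<in> arrows G" for a
      proof -
        have J: "stalk G \<pi> (src G a) \<in> ring_ideals" using stalk_ideal src_in a by blast
        show ?thesis
        proof (cases "f a = 0")
          case True
          then show ?thesis using J by (simp add: ring_ideals_def)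
        next
          case False
          then have "src G a \<in> U" using U(4) by (auto simp: supp_def restr_arrows_def)
          then have "r \<in> stalk G \<pi> (src G a)" using U by (auto simp: stalk_def)
          then show ?thesis using J by (simp add: ring_ideals_def mult.commute[of r])
        qed
      qed
      then show "scale_fun r f \<in> sections G (stalk G \<pi>)"
        using steinberg_scale[OF U(3), of r] by (simp add: sections_def scale_fun_def)
    qed
  qed (simp_all add: sections_stalk_zero sections_stalk_add sections_stalk_scale)
  show "sections G (stalk G \<pi>) \<subseteq> span_ideal G \<pi>"
  proof
    fix f assume f: "f \<in> sections G (stalk G \<pi>)"
    then have fs: "f \<in> steinberg G" by (simp add: sections_def)
    show "f \<in> span_ideal G \<pi>"
      unfolding span_ideal_def
    proof (rule steinberg_local_membership[OF fs fun_span_zero fun_span_add])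
      fix a assume a: "a \<in> arrows G"
      obtain U where U: "U \<in> open_invariants G" "src G a \<in> U" "f a \<in> \<pi> U"
        using f a by (auto simp: sections_def stalk_def)
      let ?N = "{b \<in> arrows G. src G b \<in> U}"
      have "openin (gtop G) ?N" using openin_src_vimage U(1) by (simp add: open_invariants_iff)
      moreover have "a \<in> ?N" using a U by blast
      moreover have "scale_fun (f a) (char_fun B) \<in> fun_span (\<Union>U \<in> open_invariants G.
        {scale_fun r f | r f. r \<in> \<pi> U \<and> f \<in> steinberg G \<and> supp f \<subseteq> restr_arrows G U})"
        if B: "compact_open_bisection G B" "B \<subseteq> ?N" for B
      proof (rule fun_span_base, rule UN_I[OF U(1)])
        have "char_fun B \<in> (steinberg G :: ('a \<Rightarrow> 'r) set)"
          using B(1) by (simp add: steinberg_char compact_open_bisection_def)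
        moreover have "supp (char_fun B :: 'a \<Rightarrow> 'r) \<subseteq> restr_arrows G U"
          using B(2) by (auto simp: supp_def char_fun_def restr_arrows_def split: if_splits)
        ultimately show "scale_fun (f a) (char_fun B) \<in>
          {scale_fun r f | r f. r \<in> \<pi> U \<and> f \<in> steinberg G \<and> supp f \<subseteq> restr_arrows G U}"
          using U(3) by blast
      qed
      ultimately show "\<exists>N. openin (gtop G) N \<and> a \<in> N \<and>
        (\<forall>B. compact_open_bisection G B \<and> B \<subseteq> N \<longrightarrow> scale_fun (f a) (char_fun B) \<in>
          fun_span (\<Union>U \<in> open_invariants G.
            {scale_fun r f | r f. r \<in> \<pi> U \<and> f \<in> steinberg G \<and> supp f \<subseteq> restr_arrows G U}))"
        by blast
    qed
  qed
qed

lemma scalar_function_span_ideal: "scalar_function G (span_ideal G \<pi>) = \<pi>"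
proof (rule extensionalityI[of _ "open_invariants G"])
  show "\<pi> \<in> extensional (open_invariants G)"
    using \<pi> by (auto simp: ideal_functions_def PiE_def)
  show "scalar_function G (span_ideal G \<pi>) \<in> extensional (open_invariants G)"
    by (simp add: scalar_function_def)
  fix U assume U: "U \<in> open_invariants G"
  have UG: "openin (gtop G) U" "U \<subseteq> units G"
    using U open_invariant_subset_units by (auto simp: open_invariants_iff)
  show "scalar_function G (span_ideal G \<pi>) U = \<pi> U"
  proof
    show "\<pi> U \<subseteq> scalar_function G (span_ideal G \<pi>) U"
    proof
      fix r assume r: "r \<in> \<pi> U"
      have "scale_fun r (char_fun B) \<in> span_ideal G \<pi>"
        if B: "compactin (gtop G) B" "openin (gtop G) B" "B \<subseteq> U" for B
        unfolding span_ideal_def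
      proof (rule fun_span_base, rule UN_I[OF U])
        have "char_fun B \<in> (steinberg G :: ('a \<Rightarrow> 'r) set)"
          using B by (simp add: steinberg_char)
        moreover have "b \<in> restr_arrows G U" if "b \<in> B" for b
        proof -
          have "b \<in> U" using that B(3) by blast
          then show ?thesis using UG(2) units_subset src_unit[of b] by (auto simp: restr_arrows_def)
        qed
        then have "supp (char_fun B :: 'a \<Rightarrow> 'r) \<subseteq> restr_arrows G U"
          by (auto simp: supp_def char_fun_def split: if_splits)
        ultimately show "scale_fun r (char_fun B) \<in>
          {scale_fun r f | r f. r \<in> \<pi> U \<and> f \<in> steinberg G \<and> supp f \<subseteq> restr_arrows G U}"
          using r by blast
      qed
      then show "r \<in> scalar_function G (span_ideal G \<pi>) U"
        using U by (simp add: scalar_function_def)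
    qed
    show "scalar_function G (span_ideal G \<pi>) U \<subseteq> \<pi> U"
    proof
      fix r assume "r \<in> scalar_function G (span_ideal G \<pi>) U"
      then have r: "\<And>B. \<lbrakk>compactin (gtop G) B; openin (gtop G) B; B \<subseteq> U\<rbrakk> \<Longrightarrow>
        scale_fun r (char_fun B) \<in> sections G (stalk G \<pi>)"
        using U by (simp add: scalar_function_def span_ideal_eq_sections)
      \<comment> \<open>By the stalk condition the sets in \<open>\<A>\<close> cover
        \<open>U\<close>. The union condition then gives \<open>r\<close> on the whole union, and
        antimonotonicity restricts it to \<open>U\<close>.\<close>
      define \<A> where "\<A> = {U' \<in> open_invariants G. r \<in> \<pi> U'}"
      have "U \<subseteq> \<Union>\<A>"
      proof
        fix u assume u: "u \<in> U"
        then obtain B where B: "compact_open_bisection G B" "u \<in> B" "B \<subseteq> U"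
          using compact_open_bisection_ex[OF UG(1)] by blast
        have u': "u \<in> arrows G" "src G u = u" using u UG units_subset src_unit by auto
        have "scale_fun r (char_fun B) \<in> sections G (stalk G \<pi>)"
          using r B by (simp add: compact_open_bisection_def)
        then have "scale_fun r (char_fun B) u \<in> stalk G \<pi> (src G u)"
          using u'(1) by (simp add: sections_def)
        then have "r \<in> stalk G \<pi> u" using u' B(2) by (simp add: scale_fun_def char_fun_def)
        then show "u \<in> \<Union>\<A>" by (auto simp: stalk_def \<A>_def)
      qed
      moreover have "U \<noteq> {}" using U by (simp add: open_invariants_iff)
      ultimately have A: "\<A> \<subseteq> open_invariants G" "\<A> \<noteq> {}" by (auto simp: \<A>_def)
      have "r \<in> \<pi> (\<Union>\<A>)" using ideal_function_Union[OF A] by (auto simp: \<A>_def)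
      then show "r \<in> \<pi> U"
        using ideal_function_antimono[OF U open_invariants_Union[OF A] \<open>U \<subseteq> \<Union>\<A>\<close>] by blast
    qed
  qed
qed

end

section \<open>From ideals to functions on open invariant sets\<close>

context
  fixes I :: "('a \<Rightarrow> 'r::{comm_ring, comm_monoid_mult}) set"
  assumes se: "strongly_effective G" and I: "I \<in> steinberg_ideals G"
begin

text \<open>This pointwise criterion makes the union condition immediate. Its converse direction
  rests on \<open>ideal_eq_sections\<close>: the function \<open>r\<close> times 1_B takes values in
  the fibre ideals.\<close>

lemma scalar_function_iff:
  assumes U: "U \<in> open_invariants G"
  shows "r \<in> scalar_function G I U \<longleftrightarrow> (\<forall>u \<in> U. r \<in> fibre_ideal G I u)"
proof
  have UG: "openin (gtop G) U" "U \<subseteq> units G"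
    using U open_invariant_subset_units by (auto simp: open_invariants_iff)
  show "\<forall>u \<in> U. r \<in> fibre_ideal G I u" if r: "r \<in> scalar_function G I U"
  proof
    fix u assume "u \<in> U"
    then obtain B where B: "compact_open_bisection G B" "u \<in> B" "B \<subseteq> U"
      using compact_open_bisection_ex[OF UG(1)] by blast
    then have "scale_fun r (char_fun B) \<in> I"
      using r U by (simp add: scalar_function_def compact_open_bisection_def)
    then show "r \<in> fibre_ideal G I u"
      using B UG(2) unfolding fibre_ideal_def compact_open_bisection_def by blast
  qed
  assume r: "\<forall>u \<in> U. r \<in> fibre_ideal G I u"
  have "scale_fun r (char_fun B) \<in> I"
    if B: "compactin (gtop G) B" "openin (gtop G) B" "B \<subseteq> U" for B
  proof -
    have "scale_fun r (char_fun B) a \<in> fibre_ideal G I (src G a)" if a: "a \<in> arrows G" for a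
    proof (cases "a \<in> B")
      case True
      then have "a \<in> U" using B(3) by blast
      then have "src G a = a" using UG(2) src_unit by blast
      then show ?thesis using True r \<open>a \<in> U\<close> by (simp add: scale_fun_def char_fun_def)
    next
      case False
      have "(0::'r) \<in> fibre_ideal G I (src G a)"
        using value_in_fibre_ideal[OF I se ideal_zero[OF I] a] by simp
      then show ?thesis using False by (simp add: scale_fun_def char_fun_def)
    qed
    then have "scale_fun r (char_fun B) \<in> sections G (fibre_ideal G I)"
      using B by (simp add: sections_def steinberg_scale steinberg_char)
    then show ?thesis using ideal_eq_sections[OF I se] by simp
  qed
  then show "r \<in> scalar_function G I U" using U by (simp add: scalar_function_def)
qed

lemma scalar_function_ideal_function: "scalar_function G I \<in> ideal_functions G"
  unfolding ideal_functions_def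
proof (intro CollectI conjI allI impI PiE_I)
  show "scalar_function G I U = undefined" if "U \<notin> open_invariants G" for U
    using that by (simp add: scalar_function_def)
  show "scalar_function G I U \<in> ring_ideals" if U: "U \<in> open_invariants G" for U
    unfolding ring_ideals_def
  proof (intro CollectI conjI ballI allI)
    have UG: "U \<subseteq> units G" using U open_invariant_subset_units by blast
    show "0 \<in> scalar_function G I U"
      using U ideal_zero[OF I] by (simp add: scalar_function_def scale_fun_def)
    fix x assume x: "x \<in> scalar_function G I U"
    show "c * x \<in> scalar_function G I U" for c
      using x U ideal_scale_char[OF I] subset_trans[OF _ UG] by (simp add: scalar_function_def)
    fix y assume y: "y \<in> scalar_function G I U"
    have "scale_fun (x + y) f = (\<lambda>a. scale_fun x f a + scale_fun y f a)" for f :: "'a \<Rightarrow> 'r"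
      by (simp add: scale_fun_def distrib_right)
    then show "x + y \<in> scalar_function G I U"
      using x y U ideal_add[OF I] by (simp add: scalar_function_def)
  qed
  fix \<A> assume A: "\<A> \<subseteq> open_invariants G \<and> \<A> \<noteq> {}"
  then have "\<Union>\<A> \<in> open_invariants G" using open_invariants_Union by blast
  then show "scalar_function G I (\<Union>\<A>) = (\<Inter>U \<in> \<A>. scalar_function G I U)"
    using A by (auto simp: scalar_function_iff subset_iff)
qed

lemma stalk_scalar_function:
  assumes u: "u \<in> units G"
  shows "stalk G (scalar_function G I) u = fibre_ideal G I u"
proof
  show "stalk G (scalar_function G I) u \<subseteq> fibre_ideal G I u"
    by (auto simp: stalk_def scalar_function_iff)
  show "fibre_ideal G I u \<subseteq> stalk G (scalar_function G I) u"
  proof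
    fix r assume r: "r \<in> fibre_ideal G I u"
    \<comment> \<open>This is the largest candidate witness for \<open>r\<close> in the stalk: open
      because one \<open>W\<close> serves all its points, and invariant by
      \<open>fibre_ideal_invariant\<close>.\<close>
    define U where "U = {v \<in> units G. r \<in> fibre_ideal G I v}"
    have "openin (gtop G) U"
    proof (subst openin_subopen, rule ballI)
      fix v assume "v \<in> U"
      then obtain W where W: "compactin (gtop G) W" "openin (gtop G) W" "W \<subseteq> units G" "v \<in> W"
        "scale_fun r (char_fun W) \<in> I"
        by (auto simp: U_def fibre_ideal_def)
      then have "W \<subseteq> U" by (auto simp: U_def fibre_ideal_def)
      then show "\<exists>T. openin (gtop G) T \<and> v \<in> T \<and> T \<subseteq> U" using W by blast
    qed
    moreover have "invariant G U"
      using fibre_ideal_invariant[OF I se] rng_in by (auto simp: invariant_def U_def)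
    moreover have "u \<in> U" using r u by (simp add: U_def)
    ultimately have U: "U \<in> open_invariants G" "u \<in> U" by (auto simp: open_invariants_iff)
    then have "r \<in> scalar_function G I U" by (simp add: scalar_function_iff) (simp add: U_def)
    then show "r \<in> stalk G (scalar_function G I) u" using U by (auto simp: stalk_def)
  qed
qed

lemma span_ideal_scalar_function: "span_ideal G (scalar_function G I) = I"
proof -
  have "span_ideal G (scalar_function G I) = sections G (stalk G (scalar_function G I))"
    by (rule span_ideal_eq_sections[OF scalar_function_ideal_function])
  also have "\<dots> = sections G (fibre_ideal G I)"
    by (auto simp: sections_def stalk_scalar_function src_in)
  also have "\<dots> = I" using ideal_eq_sections[OF I se] by simp
  finally show ?thesis .
qed

end

end

section \<open>The two constructions are mutually inverse\<close>

theorem theorem4p4: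
  fixes G :: "'a groupoid"
  assumes "ample_Hausdorff_groupoid G"
    and "strongly_effective G"
  shows "\<exists>\<Gamma> :: ('a set \<Rightarrow> 'r::{comm_ring, comm_monoid_mult} set) \<Rightarrow> ('a \<Rightarrow> 'r) set.
    bij_betw \<Gamma> (ideal_functions G) (steinberg_ideals G) \<and>
    (\<forall>\<pi> \<in> ideal_functions G.
      \<Gamma> \<pi> = fun_span (\<Union>U \<in> open_invariants G.
        {scale_fun r f | r f. r \<in> \<pi> U \<and> f \<in> steinberg G \<and> supp f \<subseteq> restr_arrows G U})) \<and>
    (\<forall>\<pi> \<in> ideal_functions G. \<forall>U \<in> open_invariants G.
      \<pi> U = {r. \<forall>B. compactin (gtop G) B \<and> openin (gtop G) B \<and> B \<subseteq> U \<longrightarrow>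
        scale_fun r (char_fun B) \<in> \<Gamma> \<pi>})"
proof -
  interpret ample_Hausdorff_groupoid G by fact
  show ?thesis
  proof (intro exI[of _ "span_ideal G"] conjI ballI)
    show "bij_betw (span_ideal G) (ideal_functions G :: ('a set \<Rightarrow> 'r set) set) (steinberg_ideals G)"
    proof (rule bij_betw_byWitness[where f' = "scalar_function G"])
      show "\<forall>\<pi> \<in> (ideal_functions G :: ('a set \<Rightarrow> 'r set) set). scalar_function G (span_ideal G \<pi>) = \<pi>"
        using scalar_function_span_ideal by blast
      show "\<forall>I \<in> (steinberg_ideals G :: ('a \<Rightarrow> 'r) set set). span_ideal G (scalar_function G I) = I"
        using span_ideal_scalar_function[OF assms(2)] by blast
      show "span_ideal G ` (ideal_functions G :: ('a set \<Rightarrow> 'r set) set) \<subseteq> steinberg_ideals G"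
        using sections_stalk_steinberg_ideal span_ideal_eq_sections by fastforce
      show "scalar_function G ` (steinberg_ideals G :: ('a \<Rightarrow> 'r) set set) \<subseteq> ideal_functions G"
        using scalar_function_ideal_function[OF assms(2)] by blast
    qed
  next
    fix \<pi> :: "'a set \<Rightarrow> 'r set" and U
    assume "\<pi> \<in> ideal_functions G" "U \<in> open_invariants G"
    then have "\<pi> U = scalar_function G (span_ideal G \<pi>) U"
      by (simp add: scalar_function_span_ideal)
    also have "\<dots> = {r. \<forall>B. compactin (gtop G) B \<and> openin (gtop G) B \<and> B \<subseteq> U \<longrightarrow>
        scale_fun r (char_fun B) \<in> span_ideal G \<pi>}"
      using \<open>U \<in> open_invariants G\<close> by (simp add: scalar_function_def)
    finally show "\<pi> U = {r. \<forall>B. compactin (gtop G) B \<and> openin (gtop G) B \<and> B \<subseteq> U \<longrightarrow>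
        scale_fun r (char_fun B) \<in> span_ideal G \<pi>}" .
  qed (simp add: span_ideal_def)
qed

end
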